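(* Let $0<\lambda\le\Lambda$ be real numbers, let $N\ge 1$ be an integer, and let $g:\mathbb{R}\to\mathbb{R}$ satisfy: (g1) $g$ is locally Lipschitz; (g2) $g$ is odd; (g3) there exists $\alpha\in(0,+\infty]$ such that $g$ is positive on $(0,\alpha)$ and negative on $(\alpha,+\infty)$; and, if $N\ge 2$, also (g4) $g$ is differentiable at $0$ and $g'(0)>0$. Then, for each choice of sign $\pm$, the equation $$\mathcal{M}^{\pm}_{\lambda,\Lambda}(D^2u)+g(u)=0\qquad\text{in }\mathbb{R}^N$$ has infinitely many oscillating solutions of class $C^2(\mathbb{R}^N)$. Moreover these solutions are periodic if $N=1$, while they are localized if $N\ge 2$.
   Context: For $u\in C^2(\mathbb{R}^N,\mathbb{R})$, the Pucci extremal operators are $$\mathcal{M}^+_{\lambda,\Lambda}(D^2u)=\lambda\sum_{e_i<0}e_i+\Lambda\sum_{e_i\ge0}e_i,\qquad \mathcal{M}^-_{\lambda,\Lambda}(D^2u)=\Lambda\sum_{e_i<0}e_i+\lambda\sum_{e_i\ge0}e_i,$$ where $e_i=e_i(D^2u)$, $i=1,\dots,N$, are the eigenvalues of the Hessian matrix $D^2u$. A solution $u$ is called oscillating if it has an unbounded sequence of zeros. It is called localized if it converges to zero at infinity together with its partial derivatives up to order $2$. When $\alpha=+\infty$ in (g3), the condition on $(\alpha,+\infty)$ is void. *)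

theory Defs
  imports "HOL-Analysis.Analysis" "HOL-Computational_Algebra.Polynomial"
begin

definition partial_deriv :: "'n::finite \<Rightarrow> (real^'n \<Rightarrow> real) \<Rightarrow> real^'n \<Rightarrow> real" where
  "partial_deriv i u x = deriv (\<lambda>t. u (x + t *\<^sub>R axis i 1)) 0"

text \<open>Class C^k on the whole space: all partial derivatives up to order \<open>k\<close> exist
  everywhere and are continuous. Existence is required explicitly because \<^const>\<open>deriv\<close>
  is total.\<close>

primrec class_C :: "nat \<Rightarrow> (real^'n::finite \<Rightarrow> real) \<Rightarrow> bool" where
  "class_C 0 u \<longleftrightarrow> continuous_on UNIV u"
| "class_C (Suc k) u \<longleftrightarrow> continuous_on UNIV u \<and>
     (\<forall>i. (\<forall>x. (\<lambda>t. u (x + t *\<^sub>R axis i 1)) differentiable (at 0)) \<and>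
          class_C k (partial_deriv i u))"

definition hessian :: "(real^'n::finite \<Rightarrow> real) \<Rightarrow> real^'n \<Rightarrow> real^'n^'n" where
  "hessian u x = (\<chi> i j. partial_deriv i (partial_deriv j u) x)"

definition charpoly :: "real^'n^'n::finite \<Rightarrow> real poly" where
  "charpoly A = det (\<chi> i j. (if i = j then [:0, 1:] else 0) - [:A $ i $ j:])"

text \<open>Real eigenvalues counted with algebraic multiplicity; for a symmetric matrix this
  multiset has exactly \<open>CARD('n)\<close> elements.\<close>

definition eigenvalues :: "real^'n^'n::finite \<Rightarrow> real multiset" where
  "eigenvalues A = proots (charpoly A)"

definition pucci_plus :: "real \<Rightarrow> real \<Rightarrow> real^'n^'n::finite \<Rightarrow> real" where
  "pucci_plus l L A =
     l * (\<Sum>e\<in>#filter_mset (\<lambda>e. e < 0) (eigenvalues A). e) +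
     L * (\<Sum>e\<in>#filter_mset (\<lambda>e. e \<ge> 0) (eigenvalues A). e)"

definition pucci_minus :: "real \<Rightarrow> real \<Rightarrow> real^'n^'n::finite \<Rightarrow> real" where
  "pucci_minus l L A =
     L * (\<Sum>e\<in>#filter_mset (\<lambda>e. e < 0) (eigenvalues A). e) +
     l * (\<Sum>e\<in>#filter_mset (\<lambda>e. e \<ge> 0) (eigenvalues A). e)"

definition C2_solution ::
  "(real^'n^'n \<Rightarrow> real) \<Rightarrow> (real \<Rightarrow> real) \<Rightarrow> (real^'n::finite \<Rightarrow> real) \<Rightarrow> bool" where
  "C2_solution M g u \<longleftrightarrow> class_C 2 u \<and> (\<forall>x. M (hessian u x) + g (u x) = 0)"

definition oscillating :: "(real^'n::finite \<Rightarrow> real) \<Rightarrow> bool" where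
  "oscillating u \<longleftrightarrow> (\<exists>z :: nat \<Rightarrow> real^'n. (\<forall>k. u (z k) = 0) \<and> \<not> bounded (range z))"

definition localized :: "(real^'n::finite \<Rightarrow> real) \<Rightarrow> bool" where
  "localized u \<longleftrightarrow>
     (u \<longlongrightarrow> 0) at_infinity \<and>
     (\<forall>i. (partial_deriv i u \<longlongrightarrow> 0) at_infinity) \<and>
     (\<forall>i j. (partial_deriv i (partial_deriv j u) \<longlongrightarrow> 0) at_infinity)"

text \<open>Only used in dimension one, where a nonzero vector is just a nonzero real period.\<close>

definition periodic :: "(real^'n::finite \<Rightarrow> real) \<Rightarrow> bool" where
  "periodic u \<longleftrightarrow> (\<exists>p. p \<noteq> 0 \<and> (\<forall>x. u (x + p) = u x))"

end

theory Submission
  imports Defs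
begin

text \<open>
  The solutions are radial. For a radial function with profile \<open>v\<close> the Hessian has the eigenvalue
  \<open>v'' r\<close> once and \<open>v' r / r\<close> with multiplicity \<open>N - 1\<close>
  (\<open>eigenvalues_rank_one_update\<close>), so that the equation for \<open>M\<^sup>-\<close> becomes
  \<open>\<Theta> v'' + (N - 1) \<Theta> (v' / r) + g v = 0\<close> with an increasing piecewise linear \<open>\<Theta>\<close>. Equivalently,
  \<open>v'' = - k v - m v' / r\<close>, where \<open>k\<close> is a restoring force of the sign of \<open>v\<close> and the coefficient
  \<open>m\<close> depends on \<open>r\<close> but stays between two multiples of \<open>N - 1\<close>: an oscillator with friction. As
  \<open>g\<close> is odd, \<open>- u\<close> solves the equation for \<open>M\<^sup>+\<close> whenever \<open>u\<close> solves the one for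
  \<open>M\<^sup>-\<close>.

  For each starting value \<open>v 0 = \<eta>\<close> below \<open>\<alpha>\<close>, with \<open>v' 0 = 0\<close>, there is a global solution. The
  singularity at \<open>r = 0\<close> is dealt with by the variable \<open>s = r\<^sup>2 / 2\<close> and one contraction argument
  in a weighted space (\<open>singular_initial_value_problem\<close>). The energy
  \<open>(v')\<^sup>2 / 2 + potential v\<close> does not increase, which confines \<open>v\<close> to \<open>{-\<eta>..\<eta>}\<close>, where \<open>g\<close> has
  the right sign (\<open>abs_v_le\<close>).

  For \<open>N = 1\<close> there is no friction. If \<open>v\<close> kept its sign on a half-line, then \<open>\<bar>v\<bar>\<close> would
  be concave, hence nondecreasing, and the restoring force, bounded away from zero, would turn it
  back (\<open>concave_positive_tail_impossible\<close>). So \<open>v\<close> has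
  arbitrarily large zeros, and reflection in the turning points makes it periodic.

  For \<open>N \<ge> 2\<close>, \<open>g' 0 > 0\<close> makes the restoring force comparable to \<open>v\<close>. A Riccati comparison
  shows that \<open>v\<close> cannot keep its sign (\<open>riccati_positive_tail_impossible\<close>), and the energy,
  modified by a small multiple of \<open>v v' / r\<close>, decays like a negative power of \<open>r\<close>; so \<open>v\<close> and
  \<open>v'\<close> tend to zero, and \<open>v''\<close> does by the equation.
\<close>

section \<open>Eigenvalues of rank-one updates of scalar matrices\<close>

definition rank_one_update :: "real \<Rightarrow> real \<Rightarrow> real^'n \<Rightarrow> real^'n^'n" where
  "rank_one_update q c x = (\<chi> i j. (if i = j then q else 0) + c * (x $ i * x $ j))"

text \<open>An orthogonal change of coordinates carries \<open>x\<close> to a multiple of a basis vector, where the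
matrix becomes diagonal.\<close>

lemma det_rank_one_update:
  fixes x :: "real^'n::finite"
  shows "det (rank_one_update q c x) = q ^ (CARD('n) - 1) * (q + c * (norm x)\<^sup>2)"
proof -
  obtain k :: 'n where True by blast
  obtain f where f: "orthogonal_transformation f" "f (axis k (norm x)) = x"
  proof (rule orthogonal_transformation_exists[of "axis k (norm x)" x])
    show "norm (axis k (norm x)) = norm x" by (simp add: norm_eq_sqrt_inner[of "axis k _"] inner_axis_axis)
  qed blast
  let ?R = "matrix f" and ?a = "axis k (norm x) :: real^'n"
  have orth: "orthogonal_matrix ?R" and lin: "linear f"
    using f(1) by (auto simp: orthogonal_transformation_matrix)
  have Ra: "?R *v ?a = x" using f lin by (simp add: matrix_works)
  have RR: "?R ** transpose ?R = mat 1" using orth by (simp add: orthogonal_matrix_def)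
  have "rank_one_update q c x = ?R ** rank_one_update q c ?a ** transpose ?R"
  proof -
    have 1: "rank_one_update q c y = q *\<^sub>R mat 1 + c *\<^sub>R (\<chi> i j. y $ i * y $ j)" for y :: "real^'n"
      by (simp add: rank_one_update_def vec_eq_iff mat_def)
    have 2: "(\<chi> i j. (?R *v y) $ i * (?R *v y) $ j) = ?R ** (\<chi> i j. y $ i * y $ j) ** transpose ?R" for y
      by (simp add: vec_eq_iff matrix_matrix_mult_def matrix_vector_mult_def transpose_def
          sum_product sum_distrib_left sum_distrib_right mult_ac)
    have 3: "(X + Y) ** Z = X ** Z + Y ** Z" for X Y Z :: "real^'n^'n"
      by (vector matrix_matrix_mult_def sum.distrib[symmetric] field_simps)
    show ?thesis
      unfolding 1 using 2[of ?a] Ra RR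
      by (simp add: matrix_add_ldistrib 3 matrix_scalar_ac flip: scalar_matrix_assoc)
  qed
  then have "det (rank_one_update q c x) = det (?R ** transpose ?R) * det (rank_one_update q c ?a)"
    by (simp add: det_mul)
  also have "\<dots> = det (rank_one_update q c ?a)" by (simp add: RR)
  also have "\<dots> = (\<Prod>i\<in>UNIV. rank_one_update q c ?a $ i $ i)"
    by (rule det_diagonal) (auto simp: rank_one_update_def axis_def)
  also have "\<dots> = (\<Prod>i\<in>UNIV. if i = k then q + c * (norm x)\<^sup>2 else q)"
    by (intro prod.cong) (auto simp: rank_one_update_def axis_def power2_eq_square)
  also have "\<dots> = (q + c * (norm x)\<^sup>2) * (\<Prod>i\<in>UNIV - {k}. q)"
    by (subst prod.remove[of _ k]) (auto intro!: prod.cong)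
  finally show ?thesis by (simp add: card_Diff_singleton)
qed

lemma poly_det:
  fixes A :: "'a::comm_ring_1 poly^'n^'n::finite"
  shows "poly (det A) t = det (\<chi> i j. poly (A $ i $ j) t)"
  by (simp add: det_def poly_sum poly_prod)

text \<open>Evaluation at a real \<open>t\<close> commutes with the determinant and turns the characteristic matrix
into another matrix of the same shape, so that \<open>det_rank_one_update\<close> determines the polynomial at
every \<open>t\<close>.\<close>

lemma charpoly_rank_one_update:
  fixes x :: "real^'n::finite"
  shows "charpoly (rank_one_update q c x) = [:- q, 1:] ^ (CARD('n) - 1) * [:- (q + c * (norm x)\<^sup>2), 1:]"
proof -
  have "poly (charpoly (rank_one_update q c x)) t
      = poly ([:- q, 1:] ^ (CARD('n) - 1) * [:- (q + c * (norm x)\<^sup>2), 1:]) t" for t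
  proof -
    have "poly (charpoly (rank_one_update q c x)) t = det (rank_one_update (t - q) (- c) x)"
      unfolding charpoly_def poly_det
      by (rule arg_cong[of _ _ det]) (auto simp: rank_one_update_def vec_eq_iff)
    then show ?thesis by (simp add: det_rank_one_update algebra_simps)
  qed
  then show ?thesis by (simp add: poly_eq_poly_eq_iff[symmetric] fun_eq_iff)
qed

lemma eigenvalues_rank_one_update:
  fixes x :: "real^'n::finite"
  shows "eigenvalues (rank_one_update q c x) = add_mset (q + c * (norm x)\<^sup>2) (replicate_mset (CARD('n) - 1) q)"
  unfolding eigenvalues_def charpoly_rank_one_update
  by (subst proots_mult) (auto simp: proots_power repeat_mset_replicate_mset)

text \<open>The contribution of a single eigenvalue to the Pucci operator \<open>M\<^sup>-\<close>, for
\<open>a = \<lambda>\<close> and \<open>b = \<Lambda>\<close>; its inverse function has the slopes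
\<open>1 / \<lambda>\<close> and \<open>1 / \<Lambda>\<close>.\<close>

definition two_slope :: "real \<Rightarrow> real \<Rightarrow> real \<Rightarrow> real" where
  "two_slope a b s = (if 0 \<le> s then a * s else b * s)"

lemma pucci_minus_rank_one_update:
  fixes x :: "real^'n::finite"
  shows "pucci_minus l L (rank_one_update q c x)
      = real (CARD('n) - 1) * two_slope l L q + two_slope l L (q + c * (norm x)\<^sup>2)"
proof -
  have "filter_mset P (replicate_mset n q) = (if P q then replicate_mset n q else {#})" for P n
    by (induction n) auto
  then show ?thesis unfolding pucci_minus_def eigenvalues_rank_one_update
    by (auto simp: two_slope_def algebra_simps)
qed

text \<open>The two extremal operators are exchanged by a change of sign of the matrix. Because the
nonlinearity is odd, it suffices to study \<open>M\<^sup>-\<close> and to negate the solutions.\<close>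

lemma pucci_plus_rank_one_update:
  fixes x :: "real^'n::finite"
  shows "pucci_plus l L (rank_one_update (- q) (- c) x) = - pucci_minus l L (rank_one_update q c x)"
proof -
  have "filter_mset P (replicate_mset n q) = (if P q then replicate_mset n q else {#})" for P n and q :: real
    by (induction n) auto
  moreover have "- q + - c * (norm x)\<^sup>2 = - (q + c * (norm x)\<^sup>2)" by simp
  ultimately show ?thesis
    unfolding pucci_minus_def pucci_plus_def eigenvalues_rank_one_update
    by (cases "q = 0"; cases "q + c * (norm x)\<^sup>2 = 0")
      (auto simp: algebra_simps)
qed

section \<open>Radial functions\<close>

text \<open>A radial function is written as \<open>u x = V (\<bar>x\<bar>\<^sup>2 / 2)\<close>. The variable
\<open>s = \<bar>x\<bar>\<^sup>2 / 2\<close> is a polynomial in \<open>x\<close>, which removes the apparent singularity of polar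
coordinates from the first derivatives: \<open>\<nabla>u = Q x\<close> with \<open>Q = V'\<close>. The Hessian is
\<open>Q I + Q' x x\<^sup>T\<close>, so its eigenvalues are \<open>Q\<close> (the quotient \<open>v' / r\<close> for
\<open>v r = V (r\<^sup>2 / 2)\<close>) and, in the direction of \<open>x\<close>, \<open>P = Q + 2 s Q'\<close> (the second derivative
\<open>v''\<close>). The derivative \<open>Q'\<close> may blow up at \<open>0\<close>; continuity of \<open>P\<close> and
\<open>P 0 = Q 0\<close> make the Hessian continuous there.\<close>

locale radial_profile =
  fixes V Q P :: "real \<Rightarrow> real"
  assumes Q_cont: "continuous_on UNIV Q"
    and P_cont: "continuous_on UNIV P"
    and V_deriv: "\<And>s. (V has_real_derivative Q s) (at s)"
    and Q_deriv: "\<And>s. s > 0 \<Longrightarrow> (Q has_real_derivative (P s - Q s) / (2 * s)) (at s)"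
    and P_0: "P 0 = Q 0"

definition radial :: "(real \<Rightarrow> real) \<Rightarrow> real^'n::finite \<Rightarrow> real" where
  "radial V x = V ((norm x)\<^sup>2 / 2)"

lemma half_norm_sq_line:
  fixes x :: "real^'n::finite"
  shows "(norm (x + t *\<^sub>R axis i 1))\<^sup>2 / 2 = (norm x)\<^sup>2 / 2 + t * x $ i + t\<^sup>2 / 2"
  unfolding power2_norm_eq_inner
  by (simp add: inner_add inner_axis inner_axis' inner_axis_axis algebra_simps power2_eq_square add_divide_distrib)

lemma half_norm_sq_deriv:
  fixes x :: "real^'n::finite"
  shows "((\<lambda>t. (norm (x + t *\<^sub>R axis i 1))\<^sup>2 / 2) has_real_derivative x $ i) (at 0)"
  unfolding half_norm_sq_line by (auto intro!: derivative_eq_intros)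

lemma partial_derivI:
  assumes "((\<lambda>t. u (x + t *\<^sub>R axis i 1)) has_real_derivative D) (at 0)"
  shows "partial_deriv i u x = D" "(\<lambda>t. u (x + t *\<^sub>R axis i 1)) differentiable (at 0)"
  using assms by (auto simp: partial_deriv_def real_differentiable_def intro: DERIV_imp_deriv)

context radial_profile
begin

lemma V_cont: "continuous_on UNIV V"
  using V_deriv by (intro DERIV_continuous_on) (auto intro: has_field_derivative_at_within)

lemma continuous_on_compose_half_norm_sq:
  fixes f :: "real \<Rightarrow> real"
  assumes "continuous_on UNIV f"
  shows "continuous_on UNIV (\<lambda>x::real^'n::finite. f ((norm x)\<^sup>2 / 2))"
  by (intro continuous_on_compose2[OF assms] continuous_intros) auto

lemma radial_first_deriv:
  fixes x :: "real^'n::finite"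
  shows "((\<lambda>t. radial V (x + t *\<^sub>R axis i 1)) has_real_derivative Q ((norm x)\<^sup>2 / 2) * x $ i) (at 0)"
  unfolding radial_def
  by (rule DERIV_chain2[OF _ half_norm_sq_deriv]) (use V_deriv in simp)

lemma partial_deriv_radial:
  "partial_deriv i (radial V) = (\<lambda>x::real^'n::finite. Q ((norm x)\<^sup>2 / 2) * x $ i)"
  by (rule ext) (rule partial_derivI(1)[OF radial_first_deriv])

text \<open>At \<open>x = 0\<close> the quotient is \<open>0\<close> by the convention for division, which
gives the correct value \<open>Q 0\<close> times the identity.\<close>

definition hess :: "'n \<Rightarrow> 'n \<Rightarrow> real^'n::finite \<Rightarrow> real" where
  "hess i j x = (if i = j then Q ((norm x)\<^sup>2 / 2) else 0)
    + (P ((norm x)\<^sup>2 / 2) - Q ((norm x)\<^sup>2 / 2)) / (norm x)\<^sup>2 * (x $ i * x $ j)"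

lemma radial_second_deriv:
  fixes x :: "real^'n::finite"
  shows "((\<lambda>t. Q ((norm (x + t *\<^sub>R axis i 1))\<^sup>2 / 2) * (x + t *\<^sub>R axis i 1) $ j)
    has_real_derivative hess i j x) (at 0)"
proof (cases "x = 0")
  case True
  have "isCont (\<lambda>t. Q ((norm (t *\<^sub>R (axis i 1 :: real^'n)))\<^sup>2 / 2)) 0"
    using continuous_on_compose2[OF Q_cont, of UNIV "\<lambda>t. (norm (t *\<^sub>R (axis i 1 :: real^'n)))\<^sup>2 / 2"]
    by (auto simp: continuous_on_eq_continuous_at intro!: continuous_intros)
  then have "((\<lambda>t. Q ((norm (t *\<^sub>R (axis i 1 :: real^'n)))\<^sup>2 / 2) * t) has_real_derivative Q 0) (at 0)"
    unfolding CARAT_DERIV by (intro exI[of _ "\<lambda>t. Q ((norm (t *\<^sub>R (axis i 1 :: real^'n)))\<^sup>2 / 2)"]) auto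
  then have "((\<lambda>t. Q ((norm (t *\<^sub>R (axis i 1 :: real^'n)))\<^sup>2 / 2) * t * (axis i 1 :: real^'n) $ j)
      has_real_derivative Q 0 * (axis i 1 :: real^'n) $ j) (at 0)"
    by (rule DERIV_cmult_right)
  then show ?thesis using True by (auto simp: hess_def axis_def mult.assoc)
next
  case False
  let ?s = "(norm x)\<^sup>2 / 2"
  have s: "?s > 0" using False by simp
  have 1: "((\<lambda>t. Q ((norm (x + t *\<^sub>R axis i 1))\<^sup>2 / 2)) has_real_derivative (P ?s - Q ?s) / (2 * ?s) * x $ i) (at 0)"
    by (rule DERIV_chain2[OF _ half_norm_sq_deriv]) (use Q_deriv[OF s] in simp)
  have 2: "((\<lambda>t. (x + t *\<^sub>R axis i 1) $ j) has_real_derivative (if i = j then 1 else 0)) (at 0)"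
    by (auto intro!: derivative_eq_intros simp: axis_def)
  show ?thesis
    using DERIV_mult[OF 1 2] by (auto simp: hess_def algebra_simps)
qed

lemma partial_deriv_partial_deriv_radial:
  "partial_deriv i (partial_deriv j (radial V)) = hess i j"
  unfolding partial_deriv_radial by (rule ext) (rule partial_derivI(1)[OF radial_second_deriv])

text \<open>The part of the Hessian that contains \<open>Q'\<close> is controlled by \<open>\<bar>P - Q\<bar>\<close> alone; this yields
continuity at the origin and decay at infinity.\<close>

lemma abs_component_product_le:
  fixes x :: "real^'n::finite"
  shows "\<bar>c / (norm x)\<^sup>2 * (x $ i * x $ j)\<bar> \<le> \<bar>c\<bar>"
proof (cases "x = 0")
  case False
  have "\<bar>x $ i * x $ j\<bar> \<le> norm x * norm x"
    unfolding abs_mult by (intro mult_mono component_le_norm_cart) auto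
  then have "\<bar>c\<bar> * \<bar>x $ i * x $ j\<bar> \<le> \<bar>c\<bar> * (norm x)\<^sup>2"
    unfolding power2_eq_square by (rule mult_left_mono) simp
  then show ?thesis using False by (simp add: abs_mult pos_divide_le_eq)
qed simp

lemma continuous_on_hess: "continuous_on UNIV (hess i j :: real^'n::finite \<Rightarrow> real)"
  unfolding continuous_on_eq_continuous_at[OF open_UNIV]
proof
  fix x :: "real^'n"
  let ?f = "\<lambda>x::real^'n. (P ((norm x)\<^sup>2 / 2) - Q ((norm x)\<^sup>2 / 2)) / (norm x)\<^sup>2 * (x $ i * x $ j)"
  have c: "isCont (\<lambda>x::real^'n. Q ((norm x)\<^sup>2 / 2)) y" "isCont (\<lambda>x::real^'n. P ((norm x)\<^sup>2 / 2)) y" for y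
    using continuous_on_compose_half_norm_sq[OF Q_cont] continuous_on_compose_half_norm_sq[OF P_cont]
    by (auto simp: continuous_on_eq_continuous_at)
  have "isCont ?f x"
  proof (cases "x = 0")
    case True
    have "((\<lambda>x::real^'n. P ((norm x)\<^sup>2 / 2) - Q ((norm x)\<^sup>2 / 2)) \<longlongrightarrow> P ((norm (0::real^'n))\<^sup>2 / 2) - Q ((norm (0::real^'n))\<^sup>2 / 2)) (at 0)"
      by (intro tendsto_diff c[THEN isContD])
    then have "((\<lambda>x::real^'n. P ((norm x)\<^sup>2 / 2) - Q ((norm x)\<^sup>2 / 2)) \<longlongrightarrow> 0) (at 0)"
      by (simp add: P_0)
    then have "((\<lambda>x. \<bar>P ((norm x)\<^sup>2 / 2) - Q ((norm x)\<^sup>2 / 2)\<bar>) \<longlongrightarrow> 0) (at (0::real^'n))"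
      by (rule tendsto_rabs_zero)
    then have "(?f \<longlongrightarrow> 0) (at 0)"
      by (rule Lim_null_comparison[rotated])
        (intro always_eventually allI, unfold real_norm_def, rule abs_component_product_le)
    then show ?thesis using True by (simp add: isCont_def)
  next
    case False
    then show ?thesis by (intro continuous_intros c) auto
  qed
  then have "isCont (\<lambda>x. (if i = j then Q ((norm x)\<^sup>2 / 2) else 0) + ?f x) x"
    by (cases "i = j") (auto intro!: continuous_add c)
  then show "isCont (hess i j) x" by (simp add: hess_def[abs_def])
qed

lemma class_C_2_radial: "class_C 2 (radial V :: real^'n::finite \<Rightarrow> real)"
proof -
  have "continuous_on UNIV (radial V :: real^'n \<Rightarrow> real)"
    unfolding radial_def[abs_def] by (rule continuous_on_compose_half_norm_sq[OF V_cont])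
  moreover have "continuous_on UNIV (partial_deriv i (radial V) :: real^'n \<Rightarrow> real)" for i
    unfolding partial_deriv_radial
    by (intro continuous_intros continuous_on_compose_half_norm_sq[OF Q_cont])
  moreover have "(\<lambda>t. partial_deriv j (radial V) (x + t *\<^sub>R axis i 1)) differentiable (at 0)" for i j and x :: "real^'n"
    unfolding partial_deriv_radial by (rule partial_derivI(2)[OF radial_second_deriv])
  ultimately show ?thesis
    by (simp add: numeral_2_eq_2 partial_derivI(2)[OF radial_first_deriv]
        partial_deriv_partial_deriv_radial continuous_on_hess)
qed

lemma hessian_radial:
  fixes x :: "real^'n::finite"
  shows "hessian (radial V) x = rank_one_update (Q ((norm x)\<^sup>2 / 2))
    ((P ((norm x)\<^sup>2 / 2) - Q ((norm x)\<^sup>2 / 2)) / (norm x)\<^sup>2) x"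
  by (simp add: hessian_def partial_deriv_partial_deriv_radial hess_def rank_one_update_def)

lemma pucci_minus_hessian_radial:
  fixes x :: "real^'n::finite"
  shows "pucci_minus l L (hessian (radial V) x)
    = real (CARD('n) - 1) * two_slope l L (Q ((norm x)\<^sup>2 / 2)) + two_slope l L (P ((norm x)\<^sup>2 / 2))"
  by (simp add: hessian_radial pucci_minus_rank_one_update P_0)

lemma uminus_profile: "radial_profile (\<lambda>s. - V s) (\<lambda>s. - Q s) (\<lambda>s. - P s)"
proof
  fix s :: real assume "s > 0"
  from DERIV_minus[OF Q_deriv[OF this]]
  show "((\<lambda>s. - Q s) has_real_derivative (- P s - - Q s) / (2 * s)) (at s)"
    by (simp add: minus_divide_left)
qed (auto intro!: continuous_intros Q_cont P_cont derivative_intros V_deriv simp: P_0)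

lemma pucci_plus_hessian_uminus_radial:
  fixes x :: "real^'n::finite"
  shows "pucci_plus l L (hessian (radial (\<lambda>s. - V s)) x) = - pucci_minus l L (hessian (radial V) x)"
proof -
  interpret m: radial_profile "\<lambda>s. - V s" "\<lambda>s. - Q s" "\<lambda>s. - P s" by (rule uminus_profile)
  show ?thesis
    unfolding m.hessian_radial hessian_radial pucci_plus_rank_one_update[symmetric]
    by (simp add: minus_divide_left)
qed

text \<open>In the variable \<open>r\<close>, the function \<open>r Q\<close> is the velocity and \<open>P\<close> the acceleration of the
profile, also at \<open>r = 0\<close>.\<close>

lemma radial_velocity:
  "((\<lambda>r. V (r\<^sup>2 / 2)) has_real_derivative r * Q (r\<^sup>2 / 2)) (at r)"
proof -
  have "((\<lambda>r. r\<^sup>2 / 2) has_real_derivative r) (at r)" by (auto intro!: derivative_eq_intros)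
  from DERIV_chain2[OF V_deriv this] show ?thesis by (simp add: mult.commute)
qed

lemma radial_acceleration:
  "((\<lambda>r. r * Q (r\<^sup>2 / 2)) has_real_derivative P (r\<^sup>2 / 2)) (at r)"
proof (cases "r = 0")
  case True
  have "isCont (\<lambda>r. Q (r\<^sup>2 / 2)) 0"
    using continuous_on_compose2[OF Q_cont, of UNIV "\<lambda>r. r\<^sup>2 / 2"]
    by (auto simp: continuous_on_eq_continuous_at intro!: continuous_intros)
  then show ?thesis unfolding CARAT_DERIV True
    by (intro exI[of _ "\<lambda>r. Q (r\<^sup>2 / 2)"]) (auto simp: P_0)
next
  case False
  then have s: "r\<^sup>2 / 2 > 0" by simp
  have "((\<lambda>r. Q (r\<^sup>2 / 2)) has_real_derivative (P (r\<^sup>2 / 2) - Q (r\<^sup>2 / 2)) / (2 * (r\<^sup>2 / 2)) * r) (at r)"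
    by (rule DERIV_chain2[where f=Q and g="\<lambda>r. r\<^sup>2 / 2", OF Q_deriv[OF s]]) (auto intro!: derivative_eq_intros)
  from DERIV_mult[OF DERIV_ident this] show ?thesis
    using False by (simp add: power2_eq_square)
qed

text \<open>The first and second partial derivatives are dominated by \<open>\<bar>v'\<bar>\<close> and by
\<open>2 \<bar>v' / r\<bar> + \<bar>v''\<bar>\<close>.\<close>

lemma localized_radial:
  assumes v: "((\<lambda>r. V (r\<^sup>2 / 2)) \<longlongrightarrow> 0) at_top"
    and y: "((\<lambda>r. r * Q (r\<^sup>2 / 2)) \<longlongrightarrow> 0) at_top"
    and p: "((\<lambda>r. P (r\<^sup>2 / 2)) \<longlongrightarrow> 0) at_top"
  shows "localized (radial V :: real^'n::finite \<Rightarrow> real)"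
proof -
  have at_inf: "((\<lambda>x::real^'n. f (norm x)) \<longlongrightarrow> 0) at_infinity" if "(f \<longlongrightarrow> 0) at_top" for f :: "real \<Rightarrow> real"
    by (rule filterlim_compose[OF that filterlim_norm_at_top])
  have q: "((\<lambda>r. Q (r\<^sup>2 / 2)) \<longlongrightarrow> 0) at_top"
  proof (rule Lim_null_comparison[OF _ tendsto_rabs_zero[OF y]])
    show "\<forall>\<^sub>F r in at_top. norm (Q (r\<^sup>2 / 2)) \<le> \<bar>r * Q (r\<^sup>2 / 2)\<bar>"
      using eventually_ge_at_top[of 1]
    proof eventually_elim
      case (elim r)
      then have "1 * \<bar>Q (r\<^sup>2 / 2)\<bar> \<le> r * \<bar>Q (r\<^sup>2 / 2)\<bar>" by (intro mult_right_mono) auto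
      then show ?case using elim by (simp add: abs_mult)
    qed
  qed
  have "(radial V \<longlongrightarrow> 0) (at_infinity :: (real^'n) filter)"
    using at_inf[OF v] by (simp add: radial_def[abs_def])
  moreover have "(partial_deriv i (radial V) \<longlongrightarrow> 0) (at_infinity :: (real^'n) filter)" for i
    unfolding partial_deriv_radial
    by (rule Lim_null_comparison[OF always_eventually tendsto_rabs_zero[OF at_inf[OF y]]])
       (auto simp: abs_mult mult.commute intro!: mult_right_mono component_le_norm_cart)
  moreover have "(partial_deriv i (partial_deriv j (radial V)) \<longlongrightarrow> 0) (at_infinity :: (real^'n) filter)" for i j
    unfolding partial_deriv_partial_deriv_radial
  proof (rule Lim_null_comparison[OF always_eventually])
    show "((\<lambda>x::real^'n. \<bar>Q ((norm x)\<^sup>2 / 2)\<bar> + \<bar>P ((norm x)\<^sup>2 / 2) - Q ((norm x)\<^sup>2 / 2)\<bar>) \<longlongrightarrow> 0) at_infinity"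
      using tendsto_add[OF tendsto_rabs_zero[OF at_inf[OF q]] tendsto_rabs_zero[OF tendsto_diff[OF at_inf[OF p] at_inf[OF q], simplified]]]
      by simp
    show "\<forall>x::real^'n. norm (hess i j x) \<le> \<bar>Q ((norm x)\<^sup>2 / 2)\<bar> + \<bar>P ((norm x)\<^sup>2 / 2) - Q ((norm x)\<^sup>2 / 2)\<bar>"
    proof
      fix x :: "real^'n"
      show "norm (hess i j x) \<le> \<bar>Q ((norm x)\<^sup>2 / 2)\<bar> + \<bar>P ((norm x)\<^sup>2 / 2) - Q ((norm x)\<^sup>2 / 2)\<bar>"
        unfolding hess_def real_norm_def
        by (rule order_trans[OF abs_triangle_ineq add_mono[OF _ abs_component_product_le]]) auto
    qed
  qed
  ultimately show ?thesis by (simp add: localized_def)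
qed

end

lemma oscillating_radial:
  assumes "\<And>R. \<exists>r>R. V (r\<^sup>2 / 2) = 0"
  shows "oscillating (radial V :: real^'n::finite \<Rightarrow> real)"
proof -
  obtain i :: 'n where True by blast
  obtain r where r: "\<And>k::nat. real k < r k" "\<And>k. V ((r k)\<^sup>2 / 2) = 0"
    using choice[of "\<lambda>k s. real k < s \<and> V (s\<^sup>2 / 2) = 0"] assms by blast
  have "\<not> bounded (range (\<lambda>k. axis i (r k) :: real^'n))"
  proof
    assume "bounded (range (\<lambda>k. axis i (r k) :: real^'n))"
    then obtain B where B: "\<And>k. norm (axis i (r k) :: real^'n) \<le> B" by (auto simp: bounded_iff)
    obtain k where "B < real k" using reals_Archimedean2 by blast
    then show False using B[of k] r(1)[of k] by (simp add: norm_eq_sqrt_inner inner_axis_axis)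
  qed
  moreover have "radial V (axis i (r k) :: real^'n) = 0" for k
    using r(2)[of k] by (simp add: radial_def norm_eq_sqrt_inner inner_axis_axis)
  ultimately show ?thesis unfolding oscillating_def by (intro exI[of _ "\<lambda>k. axis i (r k)"]) simp
qed

lemma periodic_radial:
  assumes card: "CARD('n::finite) = 1" and T: "0 < T" "\<And>r. V ((r + T)\<^sup>2 / 2) = V (r\<^sup>2 / 2)"
  shows "periodic (radial V :: real^'n \<Rightarrow> real)"
proof -
  obtain i :: 'n where i: "UNIV = {i}" using card card_1_singletonE by blast
  have "radial V x = V ((x $ i)\<^sup>2 / 2)" for x :: "real^'n"
    unfolding radial_def power2_norm_eq_inner inner_vec_def i by (simp add: power2_eq_square)
  then show ?thesis unfolding periodic_def
    using T by (intro exI[of _ "axis i T"]) (auto simp: axis_eq_0_iff)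
qed

lemma uminus_radial: "radial (\<lambda>s. - V s) x = - radial V x"
  by (simp add: radial_def)

section \<open>A singular initial value problem\<close>

text \<open>For \<open>s > 0\<close> this is \<open>s\<close> to the power \<open>- (k + 1)\<close> times the integral of
\<open>\<sigma>\<^sup>k h \<sigma>\<close> over \<open>{0..s}\<close>. Written as an average it makes sense for every real \<open>s\<close>, and
continuity in \<open>s\<close>, including at the singular point \<open>s = 0\<close>, is continuity of a parameter
integral.\<close>

definition avg :: "nat \<Rightarrow> (real \<Rightarrow> real) \<Rightarrow> real \<Rightarrow> real" where
  "avg k h s = integral {0..1} (\<lambda>t. t ^ k * h (s * t))"

lemma avg_integrable:
  fixes h :: "real \<Rightarrow> real"
  assumes "continuous_on UNIV h"
  shows "(\<lambda>t. t ^ k * h (s * t)) integrable_on {0..1}"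
  by (intro integrable_continuous_real continuous_intros continuous_on_compose2[OF assms]) auto

lemma continuous_on_avg:
  assumes "continuous_on UNIV h"
  shows "continuous_on UNIV (avg k h)"
proof -
  have "continuous_on UNIV (\<lambda>s. integral (cbox 0 1) (\<lambda>t. t ^ k * h (s * t)))"
    by (intro integral_continuous_on_param)
       (auto intro!: continuous_intros continuous_on_compose2[OF assms] simp: case_prod_unfold)
  then show ?thesis by (simp add: avg_def[abs_def])
qed

lemma integral_power_01: "((\<lambda>t::real. t ^ k) has_integral 1 / real (k + 1)) {0..1}"
proof -
  have "((\<lambda>t::real. t ^ k) has_integral (1 ^ (k + 1) / real (k + 1) - 0 ^ (k + 1) / real (k + 1))) {0..1}"
  proof (rule fundamental_theorem_of_calculus)
    fix t :: real
    have "((\<lambda>t. t ^ (k + 1) / real (k + 1)) has_real_derivative t ^ k) (at t within {0..1})"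
      by (rule DERIV_cong[OF DERIV_cdivide[OF DERIV_power[OF DERIV_ident]]]) simp
    then show "((\<lambda>t. t ^ (k + 1) / real (k + 1)) has_vector_derivative t ^ k) (at t within {0..1})"
      by (simp add: has_real_derivative_iff_has_vector_derivative)
  qed simp
  then show ?thesis by simp
qed

lemma abs_avg_le:
  assumes cont: "continuous_on UNIV h" and b: "\<And>t. 0 \<le> t \<Longrightarrow> t \<le> 1 \<Longrightarrow> \<bar>h (s * t)\<bar> \<le> b"
  shows "\<bar>avg k h s\<bar> \<le> b / real (k + 1)"
proof -
  have i: "((\<lambda>t::real. t ^ k * b) has_integral (1 / real (k + 1) * b)) {0..1}"
    by (rule has_integral_mult_left[OF integral_power_01])
  have "norm (integral {0..1} (\<lambda>t. t ^ k * h (s * t))) \<le> integral {0..1} (\<lambda>t. t ^ k * b)"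
    using i b by (intro integral_norm_bound_integral avg_integrable[OF cont])
      (auto simp: abs_mult intro!: mult_left_mono)
  then show ?thesis using integral_unique[OF i] by (simp add: avg_def)
qed

lemma avg_const: "avg k (\<lambda>_. c) s = c / real (k + 1)"
  using integral_unique[OF has_integral_mult_left[OF integral_power_01[of k], of c]] by (simp add: avg_def)

lemma avg_diff:
  assumes "continuous_on UNIV h1" "continuous_on UNIV h2"
  shows "avg k h1 s - avg k h2 s = avg k (\<lambda>t. h1 t - h2 t) s"
  using integral_diff[OF avg_integrable[OF assms(1), of k s] avg_integrable[OF assms(2), of k s]]
  by (simp add: avg_def algebra_simps)

lemma has_derivative_avg_0:
  assumes cont: "continuous_on UNIV f"
  shows "((\<lambda>s. s * avg 0 f s) has_real_derivative f s) (at s)"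
proof -
  define R where "R = \<bar>s\<bar> + 1"
  obtain G where G: "\<And>x. x \<in> {-R..R} \<Longrightarrow> (G has_vector_derivative f x) (at x within {-R..R})"
    using antiderivative_continuous[OF continuous_on_subset[OF cont subset_UNIV]] by blast
  have eq: "x * avg 0 f x = G x - G 0" if x: "x \<in> {-R..R}" for x
  proof -
    have "((\<lambda>t. x * f (x * t)) has_integral (G (x * 1) - G (x * 0))) {0..1}"
    proof (rule fundamental_theorem_of_calculus)
      fix t :: real assume t: "t \<in> {0..1}"
      have xt: "x * r \<in> {-R..R}" if "r \<in> {0..1}" for r
      proof -
        have "\<bar>x * r\<bar> \<le> \<bar>x\<bar>" using that by (simp add: abs_mult mult_left_le)
        moreover have "\<bar>x\<bar> \<le> R" using x by auto
        ultimately show ?thesis by (auto simp: abs_le_iff)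
      qed
      have *: "(G has_real_derivative f (x * t)) (at (x * t) within (\<lambda>t. x * t) ` {0..1})"
        using G[OF xt[OF t]] xt unfolding has_real_derivative_iff_has_vector_derivative
        by (rule_tac has_vector_derivative_within_subset[where S="{-R..R}"]) auto
      have "((\<lambda>t. G (x * t)) has_real_derivative f (x * t) * x) (at t within {0..1})"
        by (rule DERIV_image_chain[OF *, unfolded o_def]) (auto intro!: derivative_eq_intros)
      then show "((\<lambda>t. G (x * t)) has_vector_derivative x * f (x * t)) (at t within {0..1})"
        by (simp add: has_real_derivative_iff_has_vector_derivative mult.commute)
    qed simp
    from integral_unique[OF this] show ?thesis by (simp add: avg_def)
  qed
  have "(G has_real_derivative f s) (at s within {-R<..<R})"
    unfolding has_real_derivative_iff_has_vector_derivative
    by (rule has_vector_derivative_within_subset[OF G]) (auto simp: R_def)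
  then have "(G has_real_derivative f s) (at s)"
    by (subst (asm) at_within_open) (auto simp: R_def)
  then have D: "((\<lambda>x. G x - G 0) has_real_derivative f s) (at s)"
    by (auto intro!: derivative_eq_intros)
  show ?thesis
    by (rule DERIV_cong_ev[THEN iffD2, OF refl _ refl D],
        rule eventually_mono[OF eventually_nhds_in_open[of "{-R<..<R}"]])
       (auto intro!: eq simp: R_def)
qed

lemma has_derivative_avg:
  assumes cont: "continuous_on UNIV h"
  shows "((\<lambda>s. s ^ (k + 1) * avg k h s) has_real_derivative s ^ k * h s) (at s)"
proof -
  have "(\<lambda>s. s * avg 0 (\<lambda>x. x ^ k * h x) s) = (\<lambda>s. s ^ (k + 1) * avg k h s)"
    by (simp add: fun_eq_iff avg_def power_mult_distrib mult.assoc flip: integral_mult_right)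
  moreover have "((\<lambda>s. s * avg 0 (\<lambda>x. x ^ k * h x) s) has_real_derivative s ^ k * h s) (at s)"
    by (intro has_derivative_avg_0 continuous_intros cont)
  ultimately show ?thesis by metis
qed

text \<open>Integration gains the factor \<open>1 / K\<close> in the norm with weight \<open>exp (K \<bar>s\<bar>)\<close>, which is small
for large \<open>K\<close>.\<close>

lemma primitive_exp_bound:
  assumes cont: "continuous_on UNIV f" and K: "K > 0" and f: "\<And>x. \<bar>f x\<bar> \<le> A * exp (K * \<bar>x\<bar>)"
  shows "\<bar>s * avg 0 f s\<bar> \<le> A / K * exp (K * \<bar>s\<bar>)"
proof (cases "s = 0")
  case True
  have "0 \<le> A * exp (K * \<bar>0\<bar>)" using f[of 0] by linarith
  then show ?thesis using True K by simp
next
  case False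
  have A: "0 \<le> A" using f[of 0] by simp
  have i: "((\<lambda>t. A * exp (K * \<bar>s\<bar> * t)) has_integral
      (A * exp (K * \<bar>s\<bar> * 1) / (K * \<bar>s\<bar>) - A * exp (K * \<bar>s\<bar> * 0) / (K * \<bar>s\<bar>))) {0..1}"
    using False K by (intro fundamental_theorem_of_calculus)
       (auto intro!: derivative_eq_intros simp flip: has_real_derivative_iff_has_vector_derivative)
  have "norm (integral {0..1} (\<lambda>t. t ^ 0 * f (s * t))) \<le> integral {0..1} (\<lambda>t. A * exp (K * \<bar>s\<bar> * t))"
    using i by (intro integral_norm_bound_integral avg_integrable[OF cont])
      (auto intro!: order_trans[OF f] simp: abs_mult mult.assoc)
  also have "\<dots> \<le> A * exp (K * \<bar>s\<bar>) / (K * \<bar>s\<bar>)"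
    using integral_unique[OF i] A K by simp
  finally have "\<bar>s\<bar> * \<bar>avg 0 f s\<bar> \<le> \<bar>s\<bar> * (A * exp (K * \<bar>s\<bar>) / (K * \<bar>s\<bar>))"
    by (intro mult_left_mono) (auto simp: avg_def)
  then show ?thesis using False by (simp add: abs_mult)
qed

text \<open>The equation for \<open>Q\<close> is \<open>2 s Q' + 2 (k + 1) Q = H Q V\<close> with \<open>V' = Q\<close>. Multiplied by
\<open>s\<^sup>k / 2\<close> it becomes \<open>(s\<^sup>k\<^sup>+\<^sup>1 Q)' = s\<^sup>k H Q V / 2\<close>, so that the solution which is regular at
\<open>0\<close> satisfies \<open>Q = avg k (H Q V) / 2\<close>. On continuous functions on the whole line with the
weight \<open>exp (K \<bar>s\<bar>)\<close>, the right-hand side is a contraction. Averaging against \<open>t\<^sup>k\<close> contributes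
\<open>1 / (k + 1)\<close>, so that a Lipschitz constant \<open>2 k + 1\<close> in \<open>q\<close> costs only
\<open>(2 k + 1) / (2 k + 2) < 1\<close>; the dependence on \<open>v\<close> passes through an
integration and costs an amount that the weight makes small. The solution is therefore
global at once.\<close>

theorem singular_initial_value_problem:
  fixes H :: "real \<Rightarrow> real \<Rightarrow> real" and \<eta> C :: real and k :: nat
  assumes C: "0 \<le> C"
    and lip: "\<And>q q' v v'. \<bar>H q v - H q' v'\<bar> \<le> real (2 * k + 1) * \<bar>q - q'\<bar> + C * \<bar>v - v'\<bar>"
  obtains Q V where "continuous_on UNIV Q" "V 0 = \<eta>"
    "\<And>s. (V has_real_derivative Q s) (at s)"
    "\<And>s. s > 0 \<Longrightarrow> (Q has_real_derivative (H (Q s) (V s) / 2 - real (k + 1) * Q s) / s) (at s)"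
    "H (Q 0) (V 0) = 2 * real (k + 1) * Q 0"
proof -
  define W where "W q s = \<eta> + s * avg 0 q s" for q s
  define S where "S q s = avg k (\<lambda>x. H (q x) (W q x)) s / 2" for q s
  \<comment> \<open>The weight must beat \<open>C\<close>: \<open>C / K < 1\<close> makes the contraction constant \<open>\<rho>\<close> smaller than \<open>1\<close>.\<close>
  define K where "K = C + 1"
  define \<rho> where "\<rho> = (real (2 * k + 1) + C / K) / (2 * real (k + 1))"
  have K: "K > 0" using C by (simp add: K_def)
  have \<rho>: "0 \<le> \<rho>" "\<rho> < 1"
  proof -
    have "0 \<le> C / K" "C / K < 1" using C by (auto simp: K_def)
    then show "0 \<le> \<rho>" "\<rho> < 1" unfolding \<rho>_def by (auto simp: pos_divide_less_eq)
  qed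
  have HLip: "\<bar>case_prod H p - case_prod H p'\<bar> \<le> (real (2 * k + 1) + C) * dist p p'" for p p'
  proof -
    have "dist (fst p) (fst p') \<le> dist p p'" "dist (snd p) (snd p') \<le> dist p p'"
      by (rule dist_fst_le, rule dist_snd_le)
    then have "real (2 * k + 1) * \<bar>fst p - fst p'\<bar> + C * \<bar>snd p - snd p'\<bar>
        \<le> real (2 * k + 1) * dist p p' + C * dist p p'"
      using C by (intro add_mono mult_left_mono) (auto simp: dist_real_def)
    then show ?thesis
      using lip[of "fst p" "snd p" "fst p'" "snd p'"] by (simp add: case_prod_unfold algebra_simps)
  qed
  have "(real (2 * k + 1) + C)-lipschitz_on UNIV (case_prod H)"
    using C HLip by (intro lipschitz_onI) (auto simp: dist_real_def)
  then have Hc: "continuous_on UNIV (case_prod H)"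
    by (rule lipschitz_on_continuous_on)
  have Wc: "continuous_on UNIV (W q)" if "continuous_on UNIV q" for q
    unfolding W_def[abs_def] by (intro continuous_intros continuous_on_avg that)
  have Fc: "continuous_on UNIV (\<lambda>x. H (q x) (W q x))" if "continuous_on UNIV q" for q
    using continuous_on_compose2[OF Hc continuous_on_Pair[OF that Wc[OF that]]] by simp
  have Sc: "continuous_on UNIV (S q)" if "continuous_on UNIV q" for q
    unfolding S_def[abs_def] by (intro continuous_intros continuous_on_avg Fc that) auto
  have contr: "\<bar>S q s - S q' s\<bar> \<le> \<rho> * D * exp (K * \<bar>s\<bar>)"
    if q: "continuous_on UNIV q" "continuous_on UNIV q'"
      and D: "\<And>x. \<bar>q x - q' x\<bar> \<le> D * exp (K * \<bar>x\<bar>)" for q q' D s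
  proof -
    have D0: "0 \<le> D" using D[of 0] by simp
    have WW: "\<bar>W q x - W q' x\<bar> \<le> D / K * exp (K * \<bar>x\<bar>)" for x
    proof -
      have "W q x - W q' x = x * avg 0 (\<lambda>t. q t - q' t) x"
        by (simp add: W_def avg_diff[OF q, symmetric] right_diff_distrib)
      then show ?thesis
        using primitive_exp_bound[of "\<lambda>t. q t - q' t" K D x] D K q by (auto intro: continuous_intros)
    qed
    have HH: "\<bar>H (q x) (W q x) - H (q' x) (W q' x)\<bar> \<le> (real (2 * k + 1) + C / K) * D * exp (K * \<bar>x\<bar>)" for x
    proof -
      have "\<bar>H (q x) (W q x) - H (q' x) (W q' x)\<bar>
          \<le> real (2 * k + 1) * (D * exp (K * \<bar>x\<bar>)) + C * (D / K * exp (K * \<bar>x\<bar>))"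
        by (rule order_trans[OF lip]) (intro add_mono mult_left_mono D WW C; simp)
      then show ?thesis by (simp add: algebra_simps)
    qed
    have "\<bar>avg k (\<lambda>x. H (q x) (W q x) - H (q' x) (W q' x)) s\<bar>
        \<le> ((real (2 * k + 1) + C / K) * D * exp (K * \<bar>s\<bar>)) / real (k + 1)"
    proof (rule abs_avg_le)
      fix t :: real assume t: "0 \<le> t" "t \<le> 1"
      have "\<bar>s * t\<bar> \<le> \<bar>s\<bar>" using t by (simp add: abs_mult mult_left_le)
      then have "exp (K * \<bar>s * t\<bar>) \<le> exp (K * \<bar>s\<bar>)" using K by simp
      then have "(real (2 * k + 1) + C / K) * D * exp (K * \<bar>s * t\<bar>) \<le> (real (2 * k + 1) + C / K) * D * exp (K * \<bar>s\<bar>)"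
        using C K D0 by (intro mult_left_mono) auto
      then show "\<bar>H (q (s * t)) (W q (s * t)) - H (q' (s * t)) (W q' (s * t))\<bar> \<le> (real (2 * k + 1) + C / K) * D * exp (K * \<bar>s\<bar>)"
        using HH[of "s * t"] by linarith
    qed (intro continuous_intros Fc q)
    note bound = this
    have "S q s - S q' s = avg k (\<lambda>x. H (q x) (W q x) - H (q' x) (W q' x)) s / 2"
      unfolding S_def avg_diff[OF Fc[OF q(1)] Fc[OF q(2)], symmetric] by (simp add: diff_divide_distrib)
    then have "\<bar>S q s - S q' s\<bar> = \<bar>avg k (\<lambda>x. H (q x) (W q x) - H (q' x) (W q' x)) s\<bar> / 2"
      by (simp only: abs_divide abs_numeral)
    also have "\<dots> \<le> ((real (2 * k + 1) + C / K) * D * exp (K * \<bar>s\<bar>)) / real (k + 1) / 2"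
      by (rule divide_right_mono[OF bound]) simp
    also have "\<dots> = \<rho> * D * exp (K * \<bar>s\<bar>)"
      by (simp add: \<rho>_def mult.commute)
    finally show ?thesis .
  qed
  \<comment> \<open>The bounded continuous function \<open>z\<close> represents the unknown \<open>q\<close> after removal of the weight.\<close>
  define q where "q z s = exp (K * \<bar>s\<bar>) * apply_bcontfun z s" for z :: "real \<Rightarrow>\<^sub>C real" and s
  have qc: "continuous_on UNIV (q z)" for z
    unfolding q_def[abs_def] by (intro continuous_intros) auto
  define T where "T z s = exp (- K * \<bar>s\<bar>) * S (q z) s" for z s
  have ee: "exp (- K * \<bar>s\<bar>) * exp (K * \<bar>s\<bar>) = 1" for s
    by (simp flip: exp_add)
  have TT: "\<bar>T z s - T z' s\<bar> \<le> \<rho> * dist z z'" for z z' s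
  proof -
    have "\<bar>q z x - q z' x\<bar> \<le> dist z z' * exp (K * \<bar>x\<bar>)" for x
      using dist_bounded[of z x z'] by (simp add: q_def dist_real_def abs_mult flip: right_diff_distrib)
    from contr[OF qc qc this]
    have "exp (- K * \<bar>s\<bar>) * \<bar>S (q z) s - S (q z') s\<bar> \<le> exp (- K * \<bar>s\<bar>) * (\<rho> * dist z z' * exp (K * \<bar>s\<bar>))"
      by (intro mult_left_mono) auto
    also have "\<dots> = \<rho> * dist z z'" using ee[of s] by (simp add: mult.commute mult.left_commute)
    finally show ?thesis by (simp add: T_def abs_mult flip: right_diff_distrib)
  qed
  define z0 :: "real \<Rightarrow>\<^sub>C real" where "z0 = const_bcontfun 0"
  have T0: "\<bar>T z0 s\<bar> \<le> \<bar>H 0 \<eta>\<bar>" for s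
  proof -
    have q0: "q z0 = (\<lambda>_. 0)"
      by (auto simp: q_def z0_def const_bcontfun.rep_eq)
    have "T z0 s = exp (- K * \<bar>s\<bar>) * (H 0 \<eta> / (2 * real (k + 1)))"
      by (simp add: T_def S_def q0 W_def avg_const)
    also have "\<bar>\<dots>\<bar> \<le> 1 * \<bar>H 0 \<eta> / (2 * real (k + 1))\<bar>"
      unfolding abs_mult using K by (intro mult_right_mono) auto
    also have "\<dots> = \<bar>H 0 \<eta>\<bar> / (2 * real (k + 1))" by simp
    also have "\<dots> \<le> \<bar>H 0 \<eta>\<bar> / 1" by (rule divide_left_mono) auto
    also have "\<dots> = \<bar>H 0 \<eta>\<bar>" by simp
    finally show ?thesis .
  qed
  have Tb: "T z \<in> bcontfun" for z
  proof -
    have "bounded (range (T z))"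
    proof (rule boundedI)
      fix y assume "y \<in> range (T z)"
      then obtain s where "y = T z s" by blast
      then show "norm y \<le> \<bar>H 0 \<eta>\<bar> + \<rho> * dist z (z0)"
        using TT[of z s "z0"] T0[of s] by simp
    qed
    moreover have "continuous_on UNIV (T z)"
      unfolding T_def[abs_def] by (intro continuous_intros Sc qc)
    ultimately show ?thesis by (simp add: bcontfun_def)
  qed
  have "\<exists>!z. Bcontfun (T z) = z"
  proof (rule banach_fix_type[OF \<rho>], intro allI)
    fix z z' show "dist (Bcontfun (T z)) (Bcontfun (T z')) \<le> \<rho> * dist z z'"
      by (rule dist_bound) (use TT[of z _ z'] in \<open>simp add: Bcontfun_inverse Tb dist_real_def\<close>)
  qed
  then obtain z where "Bcontfun (T z) = z" by blast
  then have "apply_bcontfun z = T z" using Bcontfun_inverse[OF Tb[of z]] by simp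
  then have fix_q: "q z s = S (q z) s" for s
    using ee[of s] by (simp add: q_def T_def mult.commute mult.left_commute)
  let ?Q = "q z" and ?V = "W (q z)"
  have Vd: "(?V has_real_derivative ?Q s) (at s)" for s
    using DERIV_add[OF DERIV_const[of \<eta>] has_derivative_avg_0[OF qc, of z s]] by (simp add: W_def[abs_def])
  have Qd: "(?Q has_real_derivative (H (?Q s) (?V s) / 2 - real (k + 1) * ?Q s) / s) (at s)" if s: "s > 0" for s
  proof -
    let ?A = "\<lambda>x. x ^ (k + 1) * avg k (\<lambda>x. H (?Q x) (?V x)) x"
    have "(?A has_real_derivative s ^ k * H (?Q s) (?V s)) (at s)"
      by (rule has_derivative_avg[OF Fc[OF qc]])
    then have "((\<lambda>x. ?A x / (2 * x ^ (k + 1))) has_real_derivative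
        ((s ^ k * H (?Q s) (?V s)) * (2 * s ^ (k + 1)) - ?A s * (2 * (real (k + 1) * s ^ k))) / (2 * s ^ (k + 1) * (2 * s ^ (k + 1)))) (at s)"
    proof (rule DERIV_divide)
      show "((\<lambda>x. 2 * x ^ (k + 1)) has_real_derivative 2 * (real (k + 1) * s ^ k)) (at s)"
        by (rule DERIV_cong[OF DERIV_cmult[OF DERIV_power[OF DERIV_ident]]]) simp
    qed (use s in auto)
    moreover have QA: "?Q x = ?A x / (2 * x ^ (k + 1))" if "x > 0" for x
      using fix_q[of x] that by (simp add: S_def)
    have "((s ^ k * H (?Q s) (?V s)) * (2 * s ^ (k + 1)) - ?A s * (2 * (real (k + 1) * s ^ k))) / (2 * s ^ (k + 1) * (2 * s ^ (k + 1)))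
       = (H (?Q s) (?V s) / 2 - real (k + 1) * ?Q s) / s"
      using s by (simp add: QA[OF s] divide_simps) (simp add: algebra_simps)
    ultimately have D: "((\<lambda>x. ?A x / (2 * x ^ (k + 1))) has_real_derivative (H (?Q s) (?V s) / 2 - real (k + 1) * ?Q s) / s) (at s)"
      by simp
    show ?thesis
      by (rule DERIV_cong_ev[THEN iffD2, OF refl _ refl D],
          rule eventually_mono[OF eventually_nhds_in_open[of "{0<..}"]])
         (use s QA in auto)
  qed
  have "avg k (\<lambda>x. H (?Q x) (?V x)) 0 = H (?Q 0) (?V 0) / real (k + 1)"
    using avg_const[of k "H (?Q 0) (?V 0)" 0] by (simp add: avg_def)
  moreover have "?Q 0 = avg k (\<lambda>x. H (?Q x) (?V x)) 0 / 2"
    using fix_q[of 0] by (simp only: S_def)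
  ultimately have "?Q 0 = H (?Q 0) (?V 0) / real (k + 1) / 2" by metis
  moreover have "h = 2 * n * a" if "a = h / n / 2" "n \<noteq> 0" for a h n :: real
    using that by simp
  ultimately have "H (?Q 0) (?V 0) = 2 * real (k + 1) * ?Q 0"
    by (metis Suc_eq_plus1 of_nat_eq_0_iff nat.distinct(2))
  then show thesis
    using that[of ?Q ?V] qc Vd Qd by (simp add: W_def)
qed

section \<open>The radial Pucci equation\<close>

text \<open>Every difference quotient of a piecewise linear function lies between its slopes. Through this
mean value statement the Pucci operator enters the Lipschitz and friction estimates.\<close>

lemma two_slope_increment:
  assumes "lo \<le> a" "a \<le> hi" "lo \<le> b" "b \<le> hi"
  obtains m where "lo \<le> m" "m \<le> hi" "two_slope a b y - two_slope a b x = m * (y - x)"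
proof (cases "x = y")
  case True
  then show thesis using that[of a] assms by simp
next
  case False
  have *: "\<exists>m. lo \<le> m \<and> m \<le> hi \<and> two_slope a b y - two_slope a b x = m * (y - x)" if "x < y" for x y
  proof -
    have "lo * (y - x) \<le> two_slope a b y - two_slope a b x \<and> two_slope a b y - two_slope a b x \<le> hi * (y - x)"
    proof (cases "0 \<le> x \<or> y < 0")
      case True
      then show ?thesis using that assms
        by (auto simp: two_slope_def mult_right_mono simp flip: right_diff_distrib)
    next
      case False
      then have "lo * y \<le> a * y" "a * y \<le> hi * y" "lo * (- x) \<le> b * (- x)" "b * (- x) \<le> hi * (- x)"
        using assms by (intro mult_right_mono; simp)+
      moreover have "two_slope a b y = a * y" "two_slope a b x = b * x"
        using False by (auto simp: two_slope_def)
      ultimately show ?thesis unfolding right_diff_distrib by linarith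
    qed
    then show ?thesis using that
      by (intro exI[of _ "(two_slope a b y - two_slope a b x) / (y - x)"]) (auto simp: field_simps)
  qed
  show thesis
  proof (cases "x < y")
    case True then show thesis using *[of x y] that by blast
  next
    case lt: False
    then obtain m where "lo \<le> m" "m \<le> hi" "two_slope a b x - two_slope a b y = m * (x - y)"
      using *[of y x] False by auto
    then show thesis using that[of m] by (simp add: algebra_simps)
  qed
qed

lemma two_slope_inverse:
  assumes "0 < a" "0 < b"
  shows "two_slope a b (two_slope (1 / a) (1 / b) t) = t"
  using assms by (auto simp: two_slope_def zero_le_divide_iff zero_le_mult_iff)

lemma two_slope_0 [simp]: "two_slope a b 0 = 0"
  by (simp add: two_slope_def)

text \<open>With \<open>d = N - 1\<close>, the radial form of the equation for \<open>M\<^sup>-\<close> is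
\<open>\<Theta> v'' + d \<Theta> (v' / r) + g v = 0\<close>, where \<open>\<Theta>\<close> has slope \<open>l\<close> on positive and \<open>L\<close> on
negative arguments. Solved for \<open>v''\<close> it says that \<open>v''\<close> is the function \<open>acceleration\<close> of
\<open>v' / r\<close> and \<open>v\<close>. The restoring force is what remains of it, up to sign, when the velocity
vanishes. Here \<open>g\<close> is globally Lipschitz and positive on the whole half-line; a general \<open>g\<close> is
reduced to this case by truncation.\<close>

locale pucci_oscillator =
  fixes l L d K :: real and g :: "real \<Rightarrow> real"
  assumes l_pos: "0 < l" and l_le_L: "l \<le> L" and d_nonneg: "0 \<le> d"
    and g_lip: "\<And>s t. \<bar>g s - g t\<bar> \<le> K * \<bar>s - t\<bar>"
    and g_odd: "\<And>s. g (- s) = - g s"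
    and g_pos: "\<And>s. 0 < s \<Longrightarrow> 0 < g s"
begin

lemma L_pos: "0 < L" using l_pos l_le_L by linarith

lemma K_nonneg: "0 \<le> K" using g_lip[of 1 0] by simp

lemma g_0 [simp]: "g 0 = 0" using g_odd[of 0] by simp

definition acceleration :: "real \<Rightarrow> real \<Rightarrow> real" where
  "acceleration q v = two_slope (1 / l) (1 / L) (- d * two_slope l L q - g v)"

definition restoring :: "real \<Rightarrow> real" where
  "restoring v = - two_slope (1 / l) (1 / L) (- g v)"

lemma acceleration_equation:
  "d * two_slope l L q + two_slope l L (acceleration q v) + g v = 0"
  using l_pos L_pos by (simp add: acceleration_def two_slope_inverse)

lemma inverse_slope_bounds: "1 / L \<le> 1 / l" "1 / L \<le> 1 / L" "1 / l \<le> 1 / l"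
  using l_pos l_le_L L_pos by (auto simp: frac_le)

text \<open>The dependence on \<open>q = v' / r\<close> acts as a friction: the force opposes the velocity, with a
coefficient between two multiples of \<open>d\<close>.\<close>

lemma acceleration_increment_q:
  obtains m where "d * l / L \<le> m" "m \<le> d * L / l" "acceleration q v - acceleration q' v = - m * (q - q')"
proof -
  obtain m1 where m1: "1 / L \<le> m1" "m1 \<le> 1 / l" "acceleration q v - acceleration q' v
      = m1 * ((- d * two_slope l L q - g v) - (- d * two_slope l L q' - g v))"
    unfolding acceleration_def
    using two_slope_increment[of "1/L" "1/l" "1/l" "1/L"] inverse_slope_bounds by metis
  obtain m2 where m2: "l \<le> m2" "m2 \<le> L" "two_slope l L q - two_slope l L q' = m2 * (q - q')"
    using two_slope_increment[of l l L L q q'] l_le_L by auto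
  have "1 / L * l \<le> m1 * m2" "m1 * m2 \<le> 1 / l * L"
    using m1 m2 l_pos L_pos order_trans[OF _ m1(1), of 0] by (intro mult_mono; simp)+
  then have "d * (1 / L * l) \<le> d * (m1 * m2)" "d * (m1 * m2) \<le> d * (1 / l * L)"
    by (auto intro!: mult_left_mono[OF _ d_nonneg] simp del: times_divide_eq_left)
  moreover have "acceleration q v - acceleration q' v = - (d * (m1 * m2)) * (q - q')"
  proof -
    have "acceleration q v - acceleration q' v = - (d * m1) * (two_slope l L q - two_slope l L q')"
      using m1(3) by (simp add: algebra_simps)
    then show ?thesis using m2(3) by simp
  qed
  ultimately show thesis using that[of "d * (m1 * m2)"] by simp
qed

lemma acceleration_lip_v: "\<bar>acceleration q v - acceleration q v'\<bar> \<le> K / l * \<bar>v - v'\<bar>"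
proof -
  obtain m1 where m1: "1 / L \<le> m1" "m1 \<le> 1 / l" "acceleration q v - acceleration q v'
      = m1 * ((- d * two_slope l L q - g v) - (- d * two_slope l L q - g v'))"
    unfolding acceleration_def
    using two_slope_increment[of "1/L" "1/l" "1/l" "1/L"] inverse_slope_bounds by metis
  have "0 \<le> m1" using m1(1) L_pos by (auto intro: order_trans[rotated])
  then have "\<bar>acceleration q v - acceleration q v'\<bar> = m1 * \<bar>g v - g v'\<bar>"
    unfolding m1(3) by (simp add: abs_mult abs_minus_commute)
  also have "\<dots> \<le> 1 / l * (K * \<bar>v - v'\<bar>)"
    using m1 \<open>0 \<le> m1\<close> g_lip l_pos by (intro mult_mono) auto
  finally show ?thesis by simp
qed

lemma restoring_eq: "restoring v = - acceleration 0 v"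
  by (simp add: restoring_def acceleration_def)

lemma restoring_pos_eq: "0 < v \<Longrightarrow> restoring v = g v / L"
  using g_pos[of v] by (simp add: restoring_def two_slope_def)

lemma restoring_neg_eq: "0 < v \<Longrightarrow> restoring (- v) = - (g v / l)"
  using g_pos[of v] by (simp add: restoring_def two_slope_def g_odd)

lemma restoring_0 [simp]: "restoring 0 = 0"
  by (simp add: restoring_def)

lemma restoring_lip: "\<bar>restoring v - restoring v'\<bar> \<le> K / l * \<bar>v - v'\<bar>"
  using acceleration_lip_v[of 0 v v'] by (simp add: restoring_eq abs_minus_commute)

lemma abs_restoring_le: "\<bar>restoring v\<bar> \<le> K / l * \<bar>v\<bar>"
  using restoring_lip[of v 0] by simp

lemma acceleration_lip:
  "\<bar>acceleration q v - acceleration q' v'\<bar> \<le> d * L / l * \<bar>q - q'\<bar> + K / l * \<bar>v - v'\<bar>"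
proof -
  obtain m where m: "d * l / L \<le> m" "m \<le> d * L / l" "acceleration q v - acceleration q' v = - m * (q - q')"
    by (rule acceleration_increment_q)
  have "0 \<le> m" using m(1) d_nonneg l_pos L_pos by (auto intro: order_trans[rotated])
  then have "\<bar>acceleration q v - acceleration q' v\<bar> \<le> d * L / l * \<bar>q - q'\<bar>"
    using m(2) unfolding m(3) abs_mult abs_minus_cancel by (intro mult_right_mono) auto
  then show ?thesis using acceleration_lip_v[of q' v v'] by linarith
qed

lemma continuous_on_acceleration:
  assumes "continuous_on UNIV Q" "continuous_on UNIV V"
  shows "continuous_on UNIV (\<lambda>s. acceleration (Q s) (V s))"
proof -
  have "(d * L / l + K / l)-lipschitz_on UNIV (\<lambda>p. acceleration (fst p) (snd p))"
  proof (rule lipschitz_onI)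
    fix p p' :: "real \<times> real"
    have c: "0 \<le> d * L / l" "0 \<le> K / l" using d_nonneg l_pos L_pos K_nonneg by auto
    have "d * L / l * \<bar>fst p - fst p'\<bar> \<le> d * L / l * dist p p'" "K / l * \<bar>snd p - snd p'\<bar> \<le> K / l * dist p p'"
      using dist_fst_le[of p p'] dist_snd_le[of p p'] c by (auto intro!: mult_left_mono simp: dist_real_def simp del: times_divide_eq_left)
    then show "dist (acceleration (fst p) (snd p)) (acceleration (fst p') (snd p')) \<le> (d * L / l + K / l) * dist p p'"
      unfolding distrib_right dist_real_def
      using acceleration_lip[of "fst p" "snd p" "fst p'" "snd p'"] by linarith
  qed (use d_nonneg l_pos L_pos K_nonneg in simp)
  from continuous_on_compose2[OF lipschitz_on_continuous_on[OF this] continuous_on_Pair[OF assms]]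
  show ?thesis by simp
qed

lemma continuous_restoring: "continuous_on UNIV restoring"
  unfolding restoring_eq[abs_def] by (intro continuous_intros continuous_on_acceleration)

text \<open>In the variable \<open>s = r\<^sup>2 / 2\<close> the equation reads \<open>2 s Q' + Q = acceleration Q V\<close>. Adding
\<open>(2 k + 1) Q\<close> on both sides for a large \<open>k\<close> turns the decreasing dependence on \<open>Q\<close> into
one with Lipschitz constant at most \<open>2 k + 1\<close>, which is the hypothesis of
\<open>singular_initial_value_problem\<close>.\<close>

theorem exists_radial_profile:
  obtains V Q where "radial_profile V Q (\<lambda>s. acceleration (Q s) (V s))" "V 0 = \<eta>"
proof -
  obtain k :: nat where k: "d * L / l \<le> real k" using real_arch_simple by blast
  define H where "H q v = acceleration q v + real (2 * k + 1) * q" for q v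
  have lip: "\<bar>H q v - H q' v'\<bar> \<le> real (2 * k + 1) * \<bar>q - q'\<bar> + K / l * \<bar>v - v'\<bar>" for q q' v v'
  proof -
    obtain m where m: "d * l / L \<le> m" "m \<le> d * L / l" "acceleration q v - acceleration q' v = - m * (q - q')"
      by (rule acceleration_increment_q)
    have m0: "0 \<le> m" using m(1) d_nonneg l_pos L_pos by (auto intro: order_trans[rotated])
    have "H q v - H q' v' = (real (2 * k + 1) - m) * (q - q') + (acceleration q' v - acceleration q' v')"
      using m(3) by (simp add: H_def algebra_simps)
    also have "\<bar>\<dots>\<bar> \<le> \<bar>(real (2 * k + 1) - m) * (q - q')\<bar> + \<bar>acceleration q' v - acceleration q' v'\<bar>"
      by (rule abs_triangle_ineq)
    also have "\<bar>(real (2 * k + 1) - m) * (q - q')\<bar> \<le> real (2 * k + 1) * \<bar>q - q'\<bar>"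
      using m m0 k unfolding abs_mult by (intro mult_right_mono) auto
    finally show ?thesis using acceleration_lip_v[of q' v v'] by linarith
  qed
  obtain Q V where QV: "continuous_on UNIV Q" "V 0 = \<eta>" "\<And>s. (V has_real_derivative Q s) (at s)"
    "\<And>s. s > 0 \<Longrightarrow> (Q has_real_derivative (H (Q s) (V s) / 2 - real (k + 1) * Q s) / s) (at s)"
    "H (Q 0) (V 0) = 2 * real (k + 1) * Q 0"
    using singular_initial_value_problem[of "K / l" H k \<eta>] lip K_nonneg l_pos by auto
  have "continuous_on UNIV V"
    using QV(3) by (intro DERIV_continuous_on) (auto intro: has_field_derivative_at_within)
  then have "radial_profile V Q (\<lambda>s. acceleration (Q s) (V s))"
  proof (unfold_locales, goal_cases)
    case (4 s)
    have "(H (Q s) (V s) / 2 - real (k + 1) * Q s) / s = (acceleration (Q s) (V s) - Q s) / (2 * s)"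
      using 4 by (simp add: H_def field_simps)
    then show ?case using QV(4)[OF 4(2)] by simp
  qed (use QV in \<open>auto intro!: continuous_on_acceleration simp: H_def algebra_simps\<close>)
  then show thesis using that QV(2) by blast
qed

text \<open>The primitive of the restoring force that vanishes at \<open>0\<close>.\<close>

definition potential :: "real \<Rightarrow> real" where
  "potential v = v * avg 0 restoring v"

lemma potential_deriv: "(potential has_real_derivative restoring v) (at v)"
  unfolding potential_def[abs_def] by (rule has_derivative_avg_0[OF continuous_restoring])

lemma potential_0 [simp]: "potential 0 = 0" by (simp add: potential_def)

lemma potential_strict_mono:
  assumes "0 \<le> a" "a < b" shows "potential a < potential b"
proof (rule DERIV_pos_imp_increasing_open[OF assms(2)])
  fix x assume "a < x" "x < b"
  then show "\<exists>y. (potential has_real_derivative y) (at x) \<and> 0 < y"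
    using potential_deriv[of x] restoring_pos_eq[of x] g_pos[of x] L_pos assms by auto
qed (auto intro!: continuous_at_imp_continuous_on DERIV_isCont[OF potential_deriv])

lemma potential_uminus_deriv: "((\<lambda>x. potential (- x)) has_real_derivative - restoring (- x)) (at x)"
  using DERIV_chain2[OF potential_deriv DERIV_minus[OF DERIV_ident]] by simp

text \<open>The restoring force is stronger on the negative side, where the slope of the inverse function is
\<open>1 / l \<ge> 1 / L\<close>. So a given energy level reaches less far on the negative side than on
the positive one, and a trajectory that starts at rest at \<open>\<eta> > 0\<close> never leaves \<open>{-\<eta>..\<eta>}\<close>. This is
the reason to start \<open>M\<^sup>-\<close> from a positive value: from a negative one, the trajectory could
overshoot to positive values beyond \<open>\<alpha>\<close>.\<close>

lemma potential_abs_le: "potential \<bar>v\<bar> \<le> potential v"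
proof (cases "0 \<le> v")
  case False
  define w where "w = - v"
  have w: "0 \<le> w" using False by (simp add: w_def)
  have "potential (- 0) - potential 0 \<le> potential (- w) - potential w"
  proof (rule DERIV_nonneg_imp_nondecreasing[OF w])
    fix x assume x: "0 \<le> x" "x \<le> w"
    have "((\<lambda>x. potential (- x) - potential x) has_real_derivative - restoring (- x) - restoring x) (at x)"
      by (intro DERIV_diff potential_uminus_deriv potential_deriv)
    moreover have "0 \<le> - restoring (- x) - restoring x"
    proof (cases "x = 0")
      case False
      then have "x > 0" using x by simp
      then show ?thesis using g_pos[of x] l_pos l_le_L
        by (simp add: restoring_pos_eq restoring_neg_eq frac_le)
    qed simp
    ultimately show "\<exists>y. ((\<lambda>x. potential (- x) - potential x) has_real_derivative y) (at x) \<and> 0 \<le> y" by blast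
  qed
  then show ?thesis using False by (simp add: w_def)
qed simp

lemma potential_le: "potential w \<le> K / l * w\<^sup>2 / 2"
proof -
  let ?M = "K / l"
  show ?thesis
  proof (cases "0 \<le> w")
    case True
    have "potential w - ?M * w\<^sup>2 / 2 \<le> potential 0 - ?M * 0\<^sup>2 / 2"
    proof (rule DERIV_nonpos_imp_nonincreasing[OF True])
      fix x :: real assume x: "0 \<le> x"
      have "((\<lambda>x. potential x - ?M * x\<^sup>2 / 2) has_real_derivative restoring x - ?M * x) (at x)"
        using l_pos by (auto intro!: derivative_eq_intros potential_deriv)
      then show "\<exists>y. ((\<lambda>x. potential x - ?M * x\<^sup>2 / 2) has_real_derivative y) (at x) \<and> y \<le> 0"
        using abs_restoring_le[of x] x by (intro exI[of _ "restoring x - ?M * x"]) auto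
    qed
    then show ?thesis by simp
  next
    case False
    have "potential 0 - ?M * 0\<^sup>2 / 2 \<ge> potential w - ?M * w\<^sup>2 / 2"
    proof (rule DERIV_nonneg_imp_nondecreasing[of w 0])
      fix x :: real assume x: "x \<le> 0"
      have "((\<lambda>x. potential x - ?M * x\<^sup>2 / 2) has_real_derivative restoring x - ?M * x) (at x)"
        using l_pos by (auto intro!: derivative_eq_intros potential_deriv)
      then show "\<exists>y. ((\<lambda>x. potential x - ?M * x\<^sup>2 / 2) has_real_derivative y) (at x) \<and> 0 \<le> y"
        using abs_restoring_le[of x] x by (intro exI[of _ "restoring x - ?M * x"]) auto
    qed (use False in auto)
    then show ?thesis by simp
  qed
qed

end

section \<open>Functions that cannot stay positive\<close>

lemma deriv_le_imp_growth_le: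
  fixes h :: "real \<Rightarrow> real"
  assumes "a \<le> b" "\<And>x. a \<le> x \<Longrightarrow> x \<le> b \<Longrightarrow> (h has_real_derivative h' x) (at x)"
    and "\<And>x. a \<le> x \<Longrightarrow> x \<le> b \<Longrightarrow> h' x \<le> c"
  shows "h b \<le> h a + c * (b - a)"
proof -
  have "h b - c * b \<le> h a - c * a"
  proof (rule DERIV_nonpos_imp_nonincreasing[OF assms(1)])
    fix x assume "a \<le> x" "x \<le> b"
    then show "\<exists>y. ((\<lambda>x. h x - c * x) has_real_derivative y) (at x) \<and> y \<le> 0"
      using assms(2,3)[of x] by (intro exI[of _ "h' x - c"]) (auto intro!: derivative_eq_intros)
  qed
  then show ?thesis by (simp add: algebra_simps)
qed

text \<open>A positive concave function on a half-line is nondecreasing, for otherwise it would become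
negative along a tangent. Hence \<open>w\<close> stays in a compact subset of the positive numbers, where
\<open>f\<close> has a positive minimum, and the velocity \<open>z\<close> must become negative: a contradiction.\<close>

lemma concave_positive_tail_impossible:
  fixes w z a f :: "real \<Rightarrow> real"
  assumes w: "\<And>r. R \<le> r \<Longrightarrow> (w has_real_derivative z r) (at r)"
    and z: "\<And>r. R \<le> r \<Longrightarrow> (z has_real_derivative a r) (at r)"
    and pos: "\<And>r. R \<le> r \<Longrightarrow> 0 < w r" and bdd: "\<And>r. R \<le> r \<Longrightarrow> w r \<le> M"
    and f: "continuous_on UNIV f" "\<And>s. 0 < s \<Longrightarrow> 0 < f s"
    and a: "\<And>r. R \<le> r \<Longrightarrow> a r \<le> - f (w r)"
  shows False
proof -
  have a0: "a r \<le> 0" if "R \<le> r" for r using a[OF that] f(2)[OF pos[OF that]] by linarith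
  have z_nonneg: "0 \<le> z r0" if r0: "R \<le> r0" for r0
  proof (rule ccontr)
    assume "\<not> 0 \<le> z r0"
    then have neg: "z r0 < 0" by simp
    define r1 where "r1 = r0 + w r0 / (- z r0)"
    have "0 < w r0 / (- z r0)" using pos[OF r0] neg by (intro divide_pos_pos) auto
    then have r1: "r0 \<le> r1" by (simp add: r1_def)
    have "z r \<le> z r0 + 0 * (r - r0)" if "r0 \<le> r" for r
      by (rule deriv_le_imp_growth_le[OF that, where h' = a]) (use z a0 r0 in auto)
    then have "w r1 \<le> w r0 + z r0 * (r1 - r0)"
      by (intro deriv_le_imp_growth_le[OF r1, where h' = z]) (use w r0 in auto)
    also have "\<dots> = 0" using neg by (simp add: r1_def)
    finally show False using pos[of r1] r1 r0 by simp
  qed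
  have w_ge: "w R \<le> w r" if "R \<le> r" for r
    by (rule DERIV_nonneg_imp_nondecreasing[OF that]) (use w z_nonneg in blast)
  have "w R \<le> M" using bdd by simp
  then obtain s0 where s0: "s0 \<in> {w R..M}" "\<And>s. s \<in> {w R..M} \<Longrightarrow> f s0 \<le> f s"
    using continuous_attains_inf[of "{w R..M}" f] continuous_on_subset[OF f(1) subset_UNIV] by auto
  have mu: "0 < f s0" using s0(1) pos[of R] by (intro f(2)) auto
  define r1 where "r1 = R + (z R + 1) / f s0"
  have r1: "R \<le> r1" using mu z_nonneg[of R] by (simp add: r1_def)
  have "z r1 \<le> z R + (- f s0) * (r1 - R)"
    by (rule deriv_le_imp_growth_le[OF r1 z]) (use a s0(2) w_ge bdd in \<open>force+\<close>)
  also have "\<dots> = -1" using mu by (simp add: r1_def)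
  finally show False using z_nonneg[OF r1] by simp
qed

text \<open>For \<open>w > 0\<close> the quotient \<open>q = z / w\<close> satisfies the Riccati inequality
\<open>q' \<le> - c - q\<^sup>2 + (C / r) \<bar>q\<bar>\<close>. For large \<open>r\<close> the last term is absorbed by half of the
others, and then \<open>arctan (q / sqrt c)\<close> decreases at least at the rate \<open>sqrt c / 2\<close>. Since the
arctangent has range of length \<open>pi\<close>, this cannot last longer than \<open>2 pi / sqrt c\<close>.\<close>

lemma riccati_positive_tail_impossible:
  fixes w z a :: "real \<Rightarrow> real"
  assumes R: "0 < R" and c: "0 < c" and C: "0 \<le> C"
    and w: "\<And>r. R \<le> r \<Longrightarrow> (w has_real_derivative z r) (at r)"
    and z: "\<And>r. R \<le> r \<Longrightarrow> (z has_real_derivative a r) (at r)"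
    and pos: "\<And>r. R \<le> r \<Longrightarrow> 0 < w r"
    and a: "\<And>r. R \<le> r \<Longrightarrow> a r \<le> - c * w r + C / r * \<bar>z r\<bar>"
  shows False
proof -
  define R1 where "R1 = max R (C / sqrt c)"
  define h where "h r = arctan (z r / w r / sqrt c)" for r
  define h' where "h' r = (a r * w r - z r * z r) / (w r * w r) / sqrt c / (1 + (z r / w r / sqrt c)\<^sup>2)" for r
  have sc: "0 < sqrt c" "sqrt c * sqrt c = c" using c by auto
  have deriv: "(h has_real_derivative h' r) (at r)" if "R \<le> r" for r
  proof -
    have "((\<lambda>r. z r / w r) has_real_derivative (a r * w r - z r * z r) / (w r * w r)) (at r)"
      by (rule DERIV_divide[OF z[OF that] w[OF that]]) (use pos[OF that] in simp)
    from DERIV_chain2[OF DERIV_arctan DERIV_cdivide[OF this, of "sqrt c"]]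
    show ?thesis by (simp add: h_def[abs_def] h'_def divide_inverse mult.commute)
  qed
  have bound: "h' r \<le> - (sqrt c / 2)" if r: "R1 \<le> r" for r
  proof -
    have rR: "R \<le> r" and r0: "0 < r" using r R by (auto simp: R1_def)
    define q where "q = z r / w r"
    have w0: "0 < w r" using pos[OF rR] .
    have "C / sqrt c \<le> r" using r by (simp add: R1_def)
    then have "C / r \<le> sqrt c" using sc r0 by (simp add: field_simps)
    then have "C / r * \<bar>q\<bar> \<le> sqrt c * \<bar>q\<bar>" by (intro mult_right_mono) auto
    also have "\<dots> \<le> (c + q\<^sup>2) / 2"
      using sum_squares_bound[of "sqrt c" "\<bar>q\<bar>"] sc by (simp add: power2_eq_square)
    finally have Cq: "C / r * \<bar>q\<bar> \<le> (c + q\<^sup>2) / 2" .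
    have "a r / w r \<le> (- c * w r + C / r * \<bar>z r\<bar>) / w r"
      using a[OF rR] w0 by (intro divide_right_mono) auto
    also have "\<dots> = - c + C / r * \<bar>q\<bar>" using w0 by (simp add: q_def field_simps)
    finally have "a r / w r - q\<^sup>2 \<le> - (c + q\<^sup>2) / 2"
      using Cq by (simp only: minus_divide_left[symmetric] add_divide_distrib)
    moreover have "(a r * w r - z r * z r) / (w r * w r) = a r / w r - q\<^sup>2"
      using w0 by (simp add: q_def field_simps power2_eq_square)
    ultimately have "(a r * w r - z r * z r) / (w r * w r) \<le> - (c + q\<^sup>2) / 2" by simp
    then have "(a r * w r - z r * z r) / (w r * w r) / sqrt c / (1 + (q / sqrt c)\<^sup>2)
        \<le> - (c + q\<^sup>2) / 2 / sqrt c / (1 + (q / sqrt c)\<^sup>2)"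
      using sc by (intro divide_right_mono) (auto intro: add_nonneg_nonneg)
    also have "\<dots> = - (sqrt c / 2)"
    proof -
      have "1 + (q / sqrt c)\<^sup>2 = (c + q\<^sup>2) / c" using c by (simp add: power_divide field_simps)
      moreover have "c + q\<^sup>2 > 0" using c by (simp add: add_pos_nonneg)
      moreover have "- X / 2 / t / (X / (t * t)) = - (t / 2)" if "0 < X" "0 < t" for X t :: real
        using that by (simp add: field_simps)
      ultimately show ?thesis using sc by metis
    qed
    finally show ?thesis by (simp add: h'_def q_def)
  qed
  define T where "T = 2 * pi / sqrt c"
  have T: "0 \<le> T" using sc by (simp add: T_def)
  have "h (R1 + T) \<le> h R1 + (- (sqrt c / 2)) * (R1 + T - R1)"
    by (rule deriv_le_imp_growth_le[where h' = h']) (use T deriv bound in \<open>auto simp: R1_def\<close>)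
  also have "\<dots> = h R1 - pi" using sc by (simp add: T_def)
  finally show False
    using arctan_lbound[of "z (R1+T) / w (R1+T) / sqrt c"] arctan_ubound[of "z R1 / w R1 / sqrt c"]
    by (simp add: h_def)
qed

section \<open>Energy of a trajectory\<close>

locale pucci_trajectory = pucci_oscillator l L d K g + radial_profile V Q "\<lambda>s. acceleration (Q s) (V s)"
  for l L d K :: real and g V Q +
  fixes \<eta> :: real
  assumes \<eta>_pos: "0 < \<eta>" and V_0: "V 0 = \<eta>"
begin

definition v :: "real \<Rightarrow> real" where "v r = V (r\<^sup>2 / 2)"
definition y :: "real \<Rightarrow> real" where "y r = r * Q (r\<^sup>2 / 2)"
definition p :: "real \<Rightarrow> real" where "p r = acceleration (Q (r\<^sup>2 / 2)) (V (r\<^sup>2 / 2))"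
definition energy :: "real \<Rightarrow> real" where "energy r = (y r)\<^sup>2 / 2 + potential (v r)"

lemma v_deriv: "(v has_real_derivative y r) (at r)"
  unfolding v_def[abs_def] y_def by (rule radial_velocity)

lemma y_deriv: "(y has_real_derivative p r) (at r)"
  unfolding y_def[abs_def] p_def by (rule radial_acceleration)

lemma v_even: "v (- r) = v r" by (simp add: v_def)

lemma v_0: "v 0 = \<eta>" by (simp add: v_def V_0)
lemma y_0: "y 0 = 0" by (simp add: y_def)

text \<open>The conservative motion would have \<open>v'' = - restoring v\<close>; the deviation from it is a genuine
friction term.\<close>

lemma friction:
  assumes r: "0 < r"
  obtains m where "d * l / L \<le> m" "m \<le> d * L / l" "p r + restoring (v r) = - m * (y r / r)"
proof -
  obtain m where m: "d * l / L \<le> m" "m \<le> d * L / l"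
    "acceleration (Q (r\<^sup>2 / 2)) (v r) - acceleration 0 (v r) = - m * (Q (r\<^sup>2 / 2) - 0)"
    by (rule acceleration_increment_q)
  then show thesis
    using that[of m] r by (simp add: p_def v_def y_def restoring_def acceleration_def)
qed

lemma friction_bounds_nonneg: "0 \<le> d * l / L" "0 \<le> d * L / l"
  using d_nonneg l_pos L_pos by auto

lemma energy_deriv: "(energy has_real_derivative y r * (p r + restoring (v r))) (at r)"
  unfolding energy_def[abs_def]
  by (auto intro!: derivative_eq_intros y_deriv DERIV_chain2[OF potential_deriv v_deriv] simp: algebra_simps)

text \<open>The friction dissipates the energy, and the trajectory starts at rest at \<open>\<eta>\<close>.\<close>

lemma energy_le: assumes "0 \<le> r" shows "energy r \<le> potential \<eta>"
proof -
  have "energy r \<le> energy 0"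
  proof (rule DERIV_nonpos_imp_nonincreasing[OF assms])
    fix x :: real assume x: "0 \<le> x" "x \<le> r"
    have "y x * (p x + restoring (v x)) \<le> 0"
    proof (cases "x = 0")
      case False
      then have x0: "0 < x" using x by simp
      obtain m where m: "d * l / L \<le> m" "p x + restoring (v x) = - m * (y x / x)"
        using friction[OF x0] by blast
      have "0 \<le> m" using m(1) friction_bounds_nonneg(1) by linarith
      then have "0 \<le> m * ((y x)\<^sup>2 / x)" using x0 by simp
      then show ?thesis unfolding m(2) by (simp add: power2_eq_square algebra_simps)
    qed (simp add: y_0)
    then show "\<exists>D. (energy has_real_derivative D) (at x) \<and> D \<le> 0"
      using energy_deriv by blast
  qed
  then show ?thesis by (simp add: energy_def v_0 y_0)
qed

lemma abs_v_le: "\<bar>v r\<bar> \<le> \<eta>"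
proof -
  have *: "\<bar>v x\<bar> \<le> \<eta>" if x: "0 \<le> x" for x
  proof (rule ccontr)
    assume "\<not> \<bar>v x\<bar> \<le> \<eta>"
    then have "potential \<eta> < potential \<bar>v x\<bar>" using \<eta>_pos by (intro potential_strict_mono) auto
    also have "\<dots> \<le> potential (v x)" by (rule potential_abs_le)
    also have "\<dots> \<le> energy x" by (simp add: energy_def)
    also have "\<dots> \<le> potential \<eta>" by (rule energy_le[OF x])
    finally show False by simp
  qed
  show ?thesis using *[of r] *[of "- r"] by (cases "0 \<le> r") (auto simp: v_even)
qed

text \<open>Between zeros, \<open>v\<close> has a constant sign, and \<open>- v\<close> is as good as \<open>v\<close>. It thus suffices to
exclude that either of the two is positive on a half-line.\<close>

lemma zeros_if_no_positive_tails:
  assumes pos: "\<And>R. 0 < R \<Longrightarrow> (\<And>r. R \<le> r \<Longrightarrow> 0 < v r) \<Longrightarrow> False"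
    and neg: "\<And>R. 0 < R \<Longrightarrow> (\<And>r. R \<le> r \<Longrightarrow> 0 < - v r) \<Longrightarrow> False"
  obtains r where "R < r" "v r = 0"
proof (rule ccontr)
  note res = that
  assume "\<not> thesis"
  then have no: "v r \<noteq> 0" if "R < r" for r using res that by blast
  define R1 where "R1 = max 0 R + 1"
  have R1: "0 < R1" "R < R1" by (auto simp: R1_def)
  have nz: "v r \<noteq> 0" if "R1 \<le> r" for r using no[of r] R1(2) that by linarith
  have cont: "continuous_on {a..b} v" for a b
    by (auto intro!: continuous_at_imp_continuous_on DERIV_isCont[OF v_deriv])
  show False
  proof (cases "0 < v R1")
    case True
    have "0 < v r" if rR: "R1 \<le> r" for r
    proof (rule ccontr)
      assume "\<not> 0 < v r"
      then obtain x where "R1 \<le> x" "v x = 0"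
        using IVT2'[of v r 0 R1, OF _ _ rR cont[of R1 r]] True by auto
      then show False using nz by blast
    qed
    then show False using pos R1(1) by blast
  next
    case False
    have "0 < - v r" if rR: "R1 \<le> r" for r
    proof (rule ccontr)
      assume "\<not> 0 < - v r"
      then obtain x where "R1 \<le> x" "v x = 0"
        using IVT'[of v R1 0 r, OF _ _ rR cont[of R1 r]] False by auto
      then show False using nz by blast
    qed
    then show False using neg R1(1) by blast
  qed
qed

lemma restoring_ge: "0 < s \<Longrightarrow> g s / L \<le> restoring s" and restoring_uminus_le: "0 < s \<Longrightarrow> g s / L \<le> - restoring (- s)"
  using g_pos[of s] l_pos l_le_L by (auto simp: restoring_pos_eq restoring_neg_eq frac_le)

lemma continuous_g: "continuous_on UNIV g"
proof -
  have "K-lipschitz_on UNIV g" using g_lip K_nonneg by (intro lipschitz_onI) (auto simp: dist_real_def)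
  then show ?thesis by (rule lipschitz_on_continuous_on)
qed

end

section \<open>Trajectories without friction: dimension one\<close>

locale undamped_trajectory = pucci_trajectory +
  assumes d_0: "d = 0"
begin

lemma p_eq: "p r = - restoring (v r)"
  unfolding p_def v_def acceleration_def restoring_def unfolding d_0 by simp

lemma zeros: obtains r where "R < r" "v r = 0"
proof (rule zeros_if_no_positive_tails)
  fix R :: real
  assume pos: "\<And>r. R \<le> r \<Longrightarrow> 0 < v r"
  show False
    by (rule concave_positive_tail_impossible[where w = v and z = y and a = p and f = "\<lambda>s. g s / L" and R = R and M = \<eta>])
      (use v_deriv y_deriv pos abs_v_le g_pos L_pos restoring_ge
        in \<open>auto intro!: continuous_intros continuous_g simp: p_eq abs_le_iff\<close>)
next
  fix R :: real
  assume neg: "\<And>r. R \<le> r \<Longrightarrow> 0 < - v r"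
  have a: "- p r \<le> - (g (- v r) / L)" if "R \<le> r" for r
    using restoring_uminus_le[OF neg[OF that]] by (simp add: p_eq)
  show False
    by (rule concave_positive_tail_impossible[where w = "\<lambda>r. - v r" and z = "\<lambda>r. - y r" and a = "\<lambda>r. - p r" and f = "\<lambda>s. g s / L" and R = R and M = \<eta>])
      (use neg abs_v_le g_pos L_pos a
        in \<open>auto intro!: continuous_intros continuous_g DERIV_minus v_deriv y_deriv simp: abs_le_iff\<close>)
qed (use that in blast)

text \<open>Without friction the equation is autonomous and reversible: \<open>t \<mapsto> v (T + t)\<close> and
\<open>t \<mapsto> v (T - t)\<close> solve the same initial value problem when \<open>T\<close> is a turning point. Uniqueness
is a Gronwall argument for the sum of squares of the differences of positions and
velocities.\<close>

lemma reflection: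
  assumes T: "y T = 0" shows "v (T + t) = v (T - t)"
proof -
  have *: "v (T + t) = v (T - t)" if t: "0 \<le> t" for t
  proof -
    define a where "a t = v (T + t) - v (T - t)" for t
    define b where "b t = y (T + t) + y (T - t)" for t
    define b' where "b' t = p (T + t) - p (T - t)" for t
    define M where "M = 1 + K / l"
    have a: "(a has_real_derivative b t) (at t)" for t
    proof -
      have "((\<lambda>t. v (T + t)) has_real_derivative y (T + t) * 1) (at t)"
        by (rule DERIV_chain2[where f = v, OF v_deriv]) (auto intro!: derivative_eq_intros)
      moreover have "((\<lambda>t. v (T - t)) has_real_derivative y (T - t) * (- 1)) (at t)"
        by (rule DERIV_chain2[where f = v, OF v_deriv]) (auto intro!: derivative_eq_intros)
      ultimately show ?thesis unfolding a_def[abs_def] b_def by (auto intro!: derivative_eq_intros)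
    qed
    have b: "(b has_real_derivative b' t) (at t)" for t
    proof -
      have "((\<lambda>t. y (T + t)) has_real_derivative p (T + t) * 1) (at t)"
        by (rule DERIV_chain2[where f = y, OF y_deriv]) (auto intro!: derivative_eq_intros)
      moreover have "((\<lambda>t. y (T - t)) has_real_derivative p (T - t) * (- 1)) (at t)"
        by (rule DERIV_chain2[where f = y, OF y_deriv]) (auto intro!: derivative_eq_intros)
      ultimately show ?thesis unfolding b_def[abs_def] b'_def by (auto intro!: derivative_eq_intros)
    qed
    have b'_le: "\<bar>b' t\<bar> \<le> K / l * \<bar>a t\<bar>" for t
      using restoring_lip[of "v (T + t)" "v (T - t)"] by (simp add: b'_def a_def p_eq abs_minus_commute)
    define D where "D t = exp (- M * t) * ((a t)\<^sup>2 + (b t)\<^sup>2)" for t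
    have "D t \<le> D 0"
    proof (rule DERIV_nonpos_imp_nonincreasing[OF t])
      fix x
      have "(D has_real_derivative exp (- M * x) * (2 * a x * b x + 2 * b x * b' x - M * ((a x)\<^sup>2 + (b x)\<^sup>2))) (at x)"
        unfolding D_def[abs_def] by (auto intro!: derivative_eq_intros a b simp: algebra_simps)
      moreover have "2 * a x * b x + 2 * b x * b' x \<le> M * ((a x)\<^sup>2 + (b x)\<^sup>2)"
      proof -
        have 1: "2 * (\<bar>a x\<bar> * \<bar>b x\<bar>) \<le> (a x)\<^sup>2 + (b x)\<^sup>2"
          using sum_squares_bound[of "\<bar>a x\<bar>" "\<bar>b x\<bar>"] by simp
        have "a x * b x \<le> \<bar>a x\<bar> * \<bar>b x\<bar>" by (metis abs_ge_self abs_mult)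
        moreover have "b x * b' x \<le> \<bar>b x\<bar> * (K / l * \<bar>a x\<bar>)"
          using mult_left_mono[OF b'_le[of x], of "\<bar>b x\<bar>"] abs_ge_self[of "b x * b' x"] by (simp add: abs_mult)
        moreover have "K / l * (2 * (\<bar>a x\<bar> * \<bar>b x\<bar>)) \<le> K / l * ((a x)\<^sup>2 + (b x)\<^sup>2)"
          by (intro mult_left_mono 1) (use K_nonneg l_pos in auto)
        moreover have "\<bar>b x\<bar> * (K / l * \<bar>a x\<bar>) * 2 = K / l * (2 * (\<bar>a x\<bar> * \<bar>b x\<bar>))" by simp
        ultimately have "a x * b x * 2 + b x * b' x * 2 \<le> 1 * ((a x)\<^sup>2 + (b x)\<^sup>2) + K / l * ((a x)\<^sup>2 + (b x)\<^sup>2)"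
          using 1 by argo
        then show ?thesis unfolding M_def distrib_right by (simp add: mult_ac)
      qed
      ultimately show "\<exists>y. (D has_real_derivative y) (at x) \<and> y \<le> 0"
        by (auto intro!: exI mult_nonneg_nonpos)
    qed
    then have "exp (- M * t) * ((a t)\<^sup>2 + (b t)\<^sup>2) \<le> 0" using T by (simp add: D_def a_def b_def)
    then have "(a t)\<^sup>2 + (b t)\<^sup>2 \<le> 0" by (simp add: mult_le_0_iff)
    then show ?thesis by (simp add: a_def sum_power2_le_zero_iff)
  qed
  show ?thesis using *[of t] *[of "- t"] by (cases "0 \<le> t") auto
qed

text \<open>By Rolle's theorem there is a turning point \<open>T > 0\<close> between two positive zeros. The
trajectory is symmetric about \<open>T\<close> and about \<open>0\<close>, hence it has period \<open>2 T\<close>.\<close>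

lemma periodic_v: obtains T where "0 < T" "\<And>r. v (r + T) = v r"
proof -
  obtain r1 where r1: "0 < r1" "v r1 = 0" by (rule zeros)
  obtain r2 where r2: "r1 < r2" "v r2 = 0" by (rule zeros)
  obtain T where T: "r1 < T" "T < r2" "y T = 0"
    using MVT2[OF r2(1), of v y] v_deriv r1 r2 by auto
  have "v (r + 2 * T) = v r" for r
    using reflection[OF T(3), of "r + T"] by (simp add: v_even algebra_simps)
  then show thesis using that[of "2 * T"] T r1 by simp
qed

end

section \<open>Trajectories with friction: higher dimensions\<close>

text \<open>The linear lower bound on \<open>g\<close> near the origin comes from \<open>g' 0 > 0\<close>. It makes the restoring
force comparable to \<open>v\<close>, which is what excludes slow monotone decay and drives the
energy to zero.\<close>

locale damped_trajectory = pucci_trajectory +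
  fixes c
  assumes d_pos: "0 < d" and c_pos: "0 < c" and g_ge: "\<And>s. 0 < s \<Longrightarrow> s \<le> \<eta> \<Longrightarrow> c * s \<le> g s"
begin

lemma restoring_coercive:
  assumes "0 \<le> s" "s \<le> \<eta>"
  shows "c / L * s \<le> restoring s" "c / L * s \<le> - restoring (- s)"
proof -
  have "c / L * s \<le> restoring s \<and> c / L * s \<le> - restoring (- s)"
  proof (cases "s = 0")
    case False
    then have s: "0 < s" using assms by simp
    have "c * s / L \<le> g s / L" using g_ge[OF s assms(2)] L_pos by (intro divide_right_mono) auto
    then show ?thesis using restoring_ge[OF s] restoring_uminus_le[OF s] by simp
  qed simp
  then show "c / L * s \<le> restoring s" "c / L * s \<le> - restoring (- s)" by auto
qed

lemma friction_abs:
  assumes r: "0 < r" shows "\<bar>p r + restoring (v r)\<bar> \<le> d * L / l / r * \<bar>y r\<bar>"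
proof -
  obtain m where m: "d * l / L \<le> m" "m \<le> d * L / l" "p r + restoring (v r) = - m * (y r / r)"
    by (rule friction[OF r])
  have "0 \<le> m" using m(1) friction_bounds_nonneg(1) by linarith
  then have "\<bar>p r + restoring (v r)\<bar> = m * (\<bar>y r\<bar> / r)" using r unfolding m(3) by (simp add: abs_mult)
  also have "\<dots> \<le> d * L / l * (\<bar>y r\<bar> / r)" by (rule mult_right_mono[OF m(2)]) (use r in auto)
  finally show ?thesis by simp
qed

lemma zeros: obtains r where "R < r" "v r = 0"
proof (rule zeros_if_no_positive_tails)
  fix R :: real
  assume R: "0 < R" and pos: "\<And>r. R \<le> r \<Longrightarrow> 0 < v r"
  show False
  proof (rule riccati_positive_tail_impossible[where w = v and z = y and a = p and R = R and c = "c / L" and C = "d * L / l"])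
    fix r assume r: "R \<le> r"
    show "p r \<le> - (c / L) * v r + d * L / l / r * \<bar>y r\<bar>"
      using friction_abs[of r] restoring_coercive(1)[of "v r"] pos[OF r] abs_v_le[of r] r R by (simp add: abs_le_iff)
  qed (use R divide_pos_pos[OF c_pos L_pos] v_deriv y_deriv pos friction_bounds_nonneg in auto)
next
  fix R :: real
  assume R: "0 < R" and pos: "\<And>r. R \<le> r \<Longrightarrow> 0 < - v r"
  show False
  proof (rule riccati_positive_tail_impossible[where w = "\<lambda>r. - v r" and z = "\<lambda>r. - y r" and a = "\<lambda>r. - p r" and R = R and c = "c / L" and C = "d * L / l"])
    fix r assume r: "R \<le> r"
    show "- p r \<le> - (c / L) * (- v r) + d * L / l / r * \<bar>- y r\<bar>"
      using friction_abs[of r] restoring_coercive(2)[of "- v r"] pos[OF r] abs_v_le[of r] r R by (simp add: abs_le_iff)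
  qed (use R divide_pos_pos[OF c_pos L_pos] pos friction_bounds_nonneg in \<open>auto intro!: DERIV_minus v_deriv y_deriv\<close>)
qed (use that in blast)

lemma potential_ge: 
  assumes "\<bar>w\<bar> \<le> \<eta>" shows "c / L * w\<^sup>2 / 2 \<le> potential w"
proof -
  let ?s = "\<bar>w\<bar>"
  have "potential 0 - c / L * 0\<^sup>2 / 2 \<le> potential ?s - c / L * ?s\<^sup>2 / 2"
  proof (rule DERIV_nonneg_imp_nondecreasing[of 0 ?s])
    fix x assume x: "0 \<le> x" "x \<le> ?s"
    have "((\<lambda>x. potential x - c / L * x\<^sup>2 / 2) has_real_derivative restoring x - c / L * x) (at x)"
      using L_pos by (auto intro!: derivative_eq_intros potential_deriv)
    then show "\<exists>y. ((\<lambda>x. potential x - c / L * x\<^sup>2 / 2) has_real_derivative y) (at x) \<and> 0 \<le> y"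
      using restoring_coercive(1)[of x] x assms by (intro exI[of _ "restoring x - c / L * x"]) auto
  qed simp
  then show ?thesis using potential_abs_le[of w] by simp
qed

lemma v_restoring_ge: "c / L * (v r)\<^sup>2 \<le> v r * restoring (v r)"
proof (cases "0 \<le> v r")
  case True
  then have "v r * (c / L * v r) \<le> v r * restoring (v r)"
    using restoring_coercive(1)[of "v r"] abs_v_le[of r] by (intro mult_left_mono) auto
  then show ?thesis by (simp add: power2_eq_square mult_ac)
next
  case False
  then have "- v r * (c / L * (- v r)) \<le> - v r * (- restoring (- (- v r)))"
    using restoring_coercive(2)[of "- v r"] abs_v_le[of r] by (intro mult_left_mono) auto
  then show ?thesis by (simp add: power2_eq_square mult_ac)
qed

text \<open>Friction bounds the derivative of the energy by \<open>- c0 (v')\<^sup>2 / r\<close>, which is not enough while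
the velocity is small. The remedy is the modified energy \<open>W = energy + (\<beta> / r) v v'\<close>: the derivative of
\<open>v v'\<close> is \<open>(v')\<^sup>2 - v restoring v\<close> up to terms of order \<open>1 / r\<close>, and so contributes the missing
negative multiple of \<open>v\<^sup>2\<close>, while for small \<open>\<beta>\<close> the multiple of \<open>(v')\<^sup>2\<close> remains negative. Since \<open>W\<close>
is comparable to \<open>v\<^sup>2 + (v')\<^sup>2\<close> for large \<open>r\<close>, it satisfies \<open>W' \<le> - \<gamma> W / r\<close> there, and
therefore decays at least like \<open>r powr (- \<gamma>)\<close>.\<close>

lemma tendsto_0:
  shows "(v \<longlongrightarrow> 0) at_top" "(y \<longlongrightarrow> 0) at_top" "(p \<longlongrightarrow> 0) at_top"
proof -
  define c0 where "c0 = d * l / L"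
  define C where "C = d * L / l"
  define c1 where "c1 = min 1 (c / L)"
  define M where "M = K / l"
  \<comment> \<open>Half of the friction is given away to the cross term.\<close>
  define \<beta> where "\<beta> = c0 / 2"
  define S where "S r = (v r)\<^sup>2 + (y r)\<^sup>2" for r
  have c0: "0 < c0" using d_pos l_pos L_pos by (simp add: c0_def)
  have C: "0 \<le> C" using friction_bounds_nonneg by (simp add: C_def)
  have c1: "0 < c1" "c1 \<le> 1" "c1 \<le> c / L" using c_pos L_pos by (auto simp: c1_def)
  have M: "0 \<le> M" using K_nonneg l_pos by (simp add: M_def)
  have \<beta>: "0 < \<beta>" using c0 by (simp add: \<beta>_def)
  have S: "0 \<le> S r" for r by (simp add: S_def)
  have vy: "\<bar>v r * y r\<bar> \<le> S r / 2" for r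
    using sum_squares_bound[of "\<bar>v r\<bar>" "\<bar>y r\<bar>"] by (simp add: S_def abs_mult)
  define W where "W r = energy r + \<beta> / r * (v r * y r)" for r
  define W' where "W' r = y r * (p r + restoring (v r)) + (\<beta> / r * (y r * y r + v r * p r) - \<beta> / r\<^sup>2 * (v r * y r))" for r
  have W_deriv: "(W has_real_derivative W' r) (at r)" if "0 < r" for r
  proof -
    have "((\<lambda>r. \<beta> / r) has_real_derivative - (\<beta> / r\<^sup>2)) (at r)"
      using that by (auto intro!: derivative_eq_intros simp: power2_eq_square)
    moreover have "((\<lambda>r. v r * y r) has_real_derivative y r * y r + v r * p r) (at r)"
      using DERIV_mult[OF v_deriv y_deriv] by (simp add: mult.commute add.commute)
    ultimately have "((\<lambda>r. \<beta> / r * (v r * y r)) has_real_derivative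
        - (\<beta> / r\<^sup>2) * (v r * y r) + (y r * y r + v r * p r) * (\<beta> / r)) (at r)"
      by (rule DERIV_mult)
    from DERIV_add[OF energy_deriv this] show ?thesis
      unfolding W_def[abs_def] W'_def by (simp add: algebra_simps)
  qed
  \<comment> \<open>The second entry lets the terms of order \<open>1 / r\<^sup>2\<close> in \<open>W'\<close> be absorbed, the third one keeps
    \<open>W\<close> bounded below by a multiple of \<open>S\<close>.\<close>
  define R where "R = Max {1, (C + 1) / c1, 2 * \<beta> / c1}"
  have R: "1 \<le> R" "(C + 1) / c1 \<le> R" "2 * \<beta> / c1 \<le> R" by (auto simp: R_def)
  define c2 where "c2 = \<beta> * c1 / 2"
  have c2: "0 < c2" using \<beta> c1 by (simp add: c2_def)
  have W'_le: "W' r \<le> - (c2 / r * S r)" if r: "R \<le> r" for r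
  proof -
    have r0: "0 < r" "1 \<le> r" using r R by auto
    obtain m where m: "c0 \<le> m" "m \<le> C" "p r + restoring (v r) = - m * (y r / r)"
      using friction[OF r0(1)] unfolding c0_def C_def by blast
    have p: "p r = - restoring (v r) - m * (y r / r)" using m(3) by simp
    have "r * W' r = - ((m - \<beta>) * (y r)\<^sup>2) - \<beta> * (v r * restoring (v r)) - \<beta> * (m + 1) / r * (v r * y r)"
      using r0 unfolding W'_def p by (simp add: field_simps power2_eq_square)
    moreover have "\<beta> * (y r)\<^sup>2 \<le> (m - \<beta>) * (y r)\<^sup>2"
      using m(1) by (intro mult_right_mono) (auto simp: \<beta>_def)
    moreover have "\<beta> * (c1 * (y r)\<^sup>2) \<le> \<beta> * (y r)\<^sup>2"
      using \<beta> c1 by (intro mult_left_mono) (auto intro: mult_left_le_one_le)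
    moreover have "\<beta> * (c1 * (v r)\<^sup>2) \<le> \<beta> * (v r * restoring (v r))"
      using \<beta> c1 v_restoring_ge[of r] mult_right_mono[OF c1(3), of "(v r)\<^sup>2"] by (intro mult_left_mono) auto
    moreover have "- (\<beta> * (m + 1) / r * (v r * y r)) \<le> \<beta> * c1 * (S r / 2)"
    proof -
      have "(C + 1) / c1 \<le> r" using R(2) r by linarith
      then have "(C + 1) / r \<le> c1" using r0 c1 by (simp add: field_simps)
      moreover have "(m + 1) / r \<le> (C + 1) / r" using m(2) r0 by (intro divide_right_mono) auto
      ultimately have "(m + 1) / r \<le> c1" by linarith
      then have "\<beta> * ((m + 1) / r) \<le> \<beta> * c1" using \<beta> by (intro mult_left_mono) auto
      then have "\<beta> * (m + 1) / r \<le> \<beta> * c1" by simp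
      then have "\<beta> * (m + 1) / r * \<bar>v r * y r\<bar> \<le> \<beta> * c1 * (S r / 2)"
        using vy[of r] \<beta> c1 by (intro mult_mono) auto
      moreover have "- (n * x) \<le> n * \<bar>x\<bar>" if "0 \<le> n" for n x :: real
        using mult_left_mono[OF abs_ge_minus_self that, of x] by simp
      moreover have "0 \<le> \<beta> * (m + 1) / r" using \<beta> m(1) c0 r0 by simp
      ultimately show ?thesis by (metis order_trans)
    qed
    ultimately have "r * W' r \<le> - (\<beta> * (c1 * (y r)\<^sup>2)) - \<beta> * (c1 * (v r)\<^sup>2) + \<beta> * c1 * (S r / 2)"
      by linarith
    also have "\<dots> = - (c2 * S r)" by (simp add: c2_def S_def field_simps)
    finally show ?thesis using r0 by (simp add: field_simps)
  qed
  define C3 where "C3 = (1 + M + \<beta>) / 2"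
  have C3: "0 < C3" using M \<beta> by (simp add: C3_def)
  have cross: "\<bar>\<beta> / r * (v r * y r)\<bar> \<le> \<beta> / r * (S r / 2)" if "R \<le> r" for r
  proof -
    have "0 \<le> \<beta> / r" using \<beta> R(1) that by simp
    then show ?thesis
      unfolding abs_mult[of "\<beta> / r"] abs_of_nonneg[OF \<open>0 \<le> \<beta> / r\<close>] by (rule mult_left_mono[OF vy])
  qed
  have W_le: "W r \<le> C3 * S r" if r: "R \<le> r" for r
  proof -
    have "\<beta> / r \<le> \<beta>" using r R(1) \<beta> by (simp add: divide_le_eq)
    then have "\<beta> / r * (S r / 2) \<le> \<beta> * (S r / 2)" using S[of r] by (intro mult_right_mono) auto
    then have "W r \<le> (y r)\<^sup>2 / 2 + M * (v r)\<^sup>2 / 2 + \<beta> * (S r / 2)"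
      using cross[OF r] potential_le[of "v r"] unfolding W_def energy_def M_def[symmetric] by linarith
    also have "\<dots> \<le> C3 * S r"
      using M by (simp add: C3_def S_def field_simps)
    finally show ?thesis .
  qed
  have W_ge: "c1 / 4 * S r \<le> W r" if r: "R \<le> r" for r
  proof -
    have "2 * \<beta> / c1 \<le> r" using R(3) r by linarith
    then have "\<beta> / r \<le> c1 / 2" using r R(1) c1 by (simp add: field_simps)
    then have "\<beta> / r * (S r / 2) \<le> c1 / 2 * (S r / 2)" using S[of r] by (intro mult_right_mono) auto
    moreover have "c1 * (v r)\<^sup>2 / 2 \<le> potential (v r)"
      by (rule order_trans[OF divide_right_mono[OF mult_right_mono[OF c1(3)]] potential_ge[OF abs_v_le]]) auto
    moreover have "c1 * (y r)\<^sup>2 \<le> (y r)\<^sup>2" using c1 by (intro mult_left_le_one_le) auto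
    moreover have "c1 / 4 * S r = c1 * (v r)\<^sup>2 / 2 + c1 * (y r)\<^sup>2 / 2 - c1 / 2 * (S r / 2)"
      by (simp add: S_def field_simps)
    ultimately show ?thesis using cross[OF r] unfolding W_def energy_def by linarith
  qed
  define \<gamma> where "\<gamma> = c2 / C3"
  have \<gamma>: "0 < \<gamma>" using c2 C3 by (simp add: \<gamma>_def)
  have decay: "r powr \<gamma> * W r \<le> R powr \<gamma> * W R" if r: "R \<le> r" for r
  proof (rule DERIV_nonpos_imp_nonincreasing[OF r])
    fix x assume x: "R \<le> x"
    then have x0: "0 < x" using R by simp
    have "((\<lambda>r. r powr \<gamma> * W r) has_real_derivative (\<gamma> * x powr (\<gamma> - 1)) * W x + W' x * x powr \<gamma>) (at x)"
      by (rule DERIV_mult[OF has_real_derivative_powr[OF x0] W_deriv[OF x0]])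
    moreover have "(\<gamma> * x powr (\<gamma> - 1)) * W x + W' x * x powr \<gamma> = x powr \<gamma> * (W' x + \<gamma> / x * W x)"
      using x0 by (simp add: powr_diff algebra_simps)
    moreover have "\<gamma> / x * W x \<le> \<gamma> / x * (C3 * S x)"
      using W_le[OF x] \<gamma> x0 by (intro mult_left_mono) auto
    then have "W' x + \<gamma> / x * W x \<le> 0"
      using W'_le[OF x] C3 by (simp add: \<gamma>_def)
    ultimately show "\<exists>y. ((\<lambda>r. r powr \<gamma> * W r) has_real_derivative y) (at x) \<and> y \<le> 0"
      using x0 by (auto intro!: exI mult_nonneg_nonpos)
  qed
  define B where "B = 4 / c1 * (R powr \<gamma> * W R)"
  have S_le: "S r \<le> B * r powr (- \<gamma>)" if r: "R \<le> r" for r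
  proof -
    have r0: "0 < r" using r R by simp
    have "S r \<le> 4 / c1 * W r" using W_ge[OF r] c1 by (simp add: field_simps)
    also have "W r \<le> R powr \<gamma> * W R * r powr (- \<gamma>)"
      using decay[OF r] r0 by (simp add: powr_minus field_simps)
    then have "4 / c1 * W r \<le> 4 / c1 * (R powr \<gamma> * W R * r powr (- \<gamma>))"
      using c1 by (intro mult_left_mono) auto
    finally show ?thesis by (simp add: B_def mult.assoc)
  qed
  have S_lim: "(S \<longlongrightarrow> 0) at_top"
  proof (rule Lim_null_comparison)
    show "\<forall>\<^sub>F r in at_top. norm (S r) \<le> B * r powr (- \<gamma>)"
      using eventually_ge_at_top[of R] by eventually_elim (use S S_le in auto)
    show "((\<lambda>r. B * r powr (- \<gamma>)) \<longlongrightarrow> 0) at_top"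
      using tendsto_mult_right_zero[OF tendsto_neg_powr[OF _ filterlim_ident], of "- \<gamma>"] \<gamma> by simp
  qed
  have sqrt_lim: "((\<lambda>r. sqrt (S r)) \<longlongrightarrow> 0) at_top"
    using tendsto_real_sqrt[OF S_lim] by simp
  show v: "(v \<longlongrightarrow> 0) at_top"
    by (rule Lim_null_comparison[OF always_eventually sqrt_lim]) (auto simp: S_def intro!: real_le_rsqrt)
  show y: "(y \<longlongrightarrow> 0) at_top"
    by (rule Lim_null_comparison[OF always_eventually sqrt_lim]) (auto simp: S_def intro!: real_le_rsqrt)
  have "((\<lambda>r. C * \<bar>y r\<bar> + M * \<bar>v r\<bar>) \<longlongrightarrow> C * \<bar>0\<bar> + M * \<bar>0\<bar>) at_top"
    by (intro tendsto_intros v y)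
  then have lim: "((\<lambda>r. C * \<bar>y r\<bar> + M * \<bar>v r\<bar>) \<longlongrightarrow> 0) at_top" by simp
  show "(p \<longlongrightarrow> 0) at_top"
  proof (rule Lim_null_comparison[OF _ lim])
    show "\<forall>\<^sub>F r in at_top. norm (p r) \<le> C * \<bar>y r\<bar> + M * \<bar>v r\<bar>"
      using eventually_ge_at_top[of 1]
    proof eventually_elim
      case (elim r)
      have "C / r \<le> C" using C elim by (simp add: divide_le_eq mult_le_cancel_left1)
      then have "C / r * \<bar>y r\<bar> \<le> C * \<bar>y r\<bar>" by (rule mult_right_mono) simp
      moreover have "\<bar>p r + restoring (v r)\<bar> \<le> C / r * \<bar>y r\<bar>"
        using friction_abs[of r] elim by (simp add: C_def)
      ultimately show ?case using abs_restoring_le[of "v r"] unfolding M_def by (auto simp: abs_le_iff)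
    qed
  qed
qed

end

section \<open>Oscillating solutions\<close>

text \<open>Near \<open>0\<close> the bound follows from \<open>g' 0 > 0\<close>, away from \<open>0\<close> from compactness.\<close>

lemma linear_lower_bound:
  assumes diff: "g differentiable (at 0)" "deriv g 0 > 0" and g0: "g 0 = (0::real)"
    and cont: "continuous_on {0..\<eta>} g" and pos: "\<And>s. 0 < s \<Longrightarrow> s \<le> \<eta> \<Longrightarrow> 0 < g s" and \<eta>: "0 < \<eta>"
  obtains c where "0 < c" "\<And>s. 0 < s \<Longrightarrow> s \<le> \<eta> \<Longrightarrow> c * s \<le> g s"
proof -
  let ?D = "deriv g 0"
  have "(g has_real_derivative ?D) (at 0)"
    using diff(1) by (simp add: DERIV_deriv_iff_real_differentiable)
  then have "((\<lambda>s. g s / s) \<longlongrightarrow> ?D) (at 0)" by (simp add: DERIV_def g0)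
  then have "\<forall>\<^sub>F s in at 0. ?D / 2 < g s / s" using diff(2) by (intro order_tendstoD(1)) auto
  then obtain e where e: "0 < e" "\<And>s. s \<noteq> 0 \<Longrightarrow> \<bar>s\<bar> < e \<Longrightarrow> ?D / 2 < g s / s"
    unfolding eventually_at by (auto simp: dist_real_def)
  define e' where "e' = min e \<eta>"
  have e': "0 < e'" "e' \<le> e" "e' \<le> \<eta>" using e \<eta> by (auto simp: e'_def)
  obtain s0 where s0: "s0 \<in> {e'..\<eta>}" "\<And>s. s \<in> {e'..\<eta>} \<Longrightarrow> g s0 \<le> g s"
    using continuous_attains_inf[of "{e'..\<eta>}" g] continuous_on_subset[OF cont, of "{e'..\<eta>}"] e' by auto
  have gs0: "0 < g s0" using s0(1) e' by (intro pos) auto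
  define c where "c = min (?D / 2) (g s0 / \<eta>)"
  show thesis
  proof
    show "0 < c" using diff(2) gs0 \<eta> by (simp add: c_def)
    fix s assume s: "0 < s" "s \<le> \<eta>"
    show "c * s \<le> g s"
    proof (cases "s < e'")
      case True
      then have "deriv g 0 / 2 < g s / s" using e(2)[of s] e' s by auto
      then have "c \<le> g s / s" unfolding c_def by linarith
      then show ?thesis using s by (simp add: field_simps)
    next
      case False
      have "c * s \<le> g s0 / \<eta> * \<eta>" using s gs0 \<eta> by (intro mult_mono) (auto simp: c_def)
      also have "\<dots> \<le> g s" using s0(2)[of s] False s \<eta> by simp
      finally show ?thesis .
    qed
  qed
qed

text \<open>Replacing \<open>g\<close> by its value at the nearest point of \<open>{-\<eta>..\<eta>}\<close> gives a globally Lipschitz function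
of the same sign. The energy bound confines the trajectory to \<open>{-\<eta>..\<eta>}\<close>, so that it solves
the original equation as well.\<close>

lemma exists_radial_solutions:
  fixes l L \<eta> :: real and g :: "real \<Rightarrow> real"
  assumes l: "0 < l" "l \<le> L"
    and g1: "local_lipschitz (UNIV :: real set) UNIV (\<lambda>_. g)"
    and g2: "\<And>s. g (- s) = - g s"
    and \<eta>: "0 < \<eta>" and g_pos: "\<And>s. 0 < s \<Longrightarrow> s \<le> \<eta> \<Longrightarrow> 0 < g s"
    and g4: "CARD('n::finite) \<ge> 2 \<Longrightarrow> g differentiable (at 0) \<and> deriv g 0 > 0"
  obtains u :: "real^'n \<Rightarrow> real"
  where "u 0 = \<eta>"
    "C2_solution (pucci_minus l L) g u" "C2_solution (pucci_plus l L) g (\<lambda>x. - u x)"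
    "oscillating u" "oscillating (\<lambda>x. - u x)"
    "CARD('n) = 1 \<Longrightarrow> periodic u" "CARD('n) = 1 \<Longrightarrow> periodic (\<lambda>x. - u x)"
    "CARD('n) \<ge> 2 \<Longrightarrow> localized u" "CARD('n) \<ge> 2 \<Longrightarrow> localized (\<lambda>x. - u x)"
proof -
  have loc: "local_lipschitz {0::real} {-\<eta>..\<eta>} (\<lambda>_. g)"
    by (rule local_lipschitz_subset[OF g1]) auto
  obtain K where K: "K-lipschitz_on {-\<eta>..\<eta>} g"
    by (rule local_lipschitz_compact_implies_lipschitz[OF loc]) auto
  define clamp where "clamp s = max (- \<eta>) (min \<eta> s)" for s
  define h where "h s = g (clamp s)" for s
  have h_eq: "h s = g s" if "\<bar>s\<bar> \<le> \<eta>" for s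
    using that by (auto simp: h_def clamp_def)
  define d where "d = real (CARD('n) - 1)"
  interpret O: pucci_oscillator l L d K h
  proof
    fix s t
    have "\<bar>h s - h t\<bar> \<le> K * \<bar>clamp s - clamp t\<bar>"
      using lipschitz_onD[OF K, of "clamp s" "clamp t"] \<eta> by (auto simp: h_def clamp_def dist_real_def)
    also have "\<dots> \<le> K * \<bar>s - t\<bar>"
      using lipschitz_on_nonneg[OF K] by (intro mult_left_mono) (auto simp: clamp_def)
    finally show "\<bar>h s - h t\<bar> \<le> K * \<bar>s - t\<bar>" .
    have "clamp (- s) = - clamp s" using \<eta> by (auto simp: clamp_def min_def max_def)
    then show "h (- s) = - h s" by (simp add: h_def g2)
    show "0 < h s" if "0 < s" using that \<eta> g_pos[of "clamp s"] by (auto simp: h_def clamp_def)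
  qed (use l in \<open>auto simp: d_def\<close>)
  obtain V Q where VQ: "radial_profile V Q (\<lambda>s. O.acceleration (Q s) (V s))" "V 0 = \<eta>"
    using O.exists_radial_profile by blast
  interpret T: pucci_trajectory l L d K h V Q \<eta>
    by (intro pucci_trajectory.intro pucci_trajectory_axioms.intro O.pucci_oscillator_axioms VQ \<eta>)
  let ?u = "radial V :: real^'n \<Rightarrow> real" and ?v = "radial (\<lambda>s. - V s) :: real^'n \<Rightarrow> real"
  interpret m: radial_profile "\<lambda>s. - V s" "\<lambda>s. - Q s" "\<lambda>s. - O.acceleration (Q s) (V s)"
    by (rule T.uminus_profile)
  have u_eq: "(\<lambda>x. - ?u x) = ?v" by (simp add: fun_eq_iff uminus_radial)
  have eqn: "pucci_minus l L (hessian ?u x) + g (?u x) = 0" for x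
  proof -
    have "h (?u x) = g (?u x)"
      using T.abs_v_le[of "norm x"] by (intro h_eq) (simp add: T.v_def radial_def)
    then show ?thesis
      using O.acceleration_equation[of "Q ((norm x)\<^sup>2 / 2)" "V ((norm x)\<^sup>2 / 2)"]
      by (simp add: T.pucci_minus_hessian_radial d_def) (simp add: radial_def)
  qed
  then have sol: "C2_solution (pucci_minus l L) g ?u" "C2_solution (pucci_plus l L) g ?v"
    by (auto simp: C2_solution_def T.class_C_2_radial m.class_C_2_radial T.pucci_plus_hessian_uminus_radial
        uminus_radial g2) (smt (verit, best))
  have zeros: "\<exists>r>R. V (r\<^sup>2 / 2) = 0"
    and per: "CARD('n) = 1 \<Longrightarrow> periodic ?u \<and> periodic ?v"
    and loc: "CARD('n) \<ge> 2 \<Longrightarrow> localized ?u \<and> localized ?v" for R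
  proof -
    have "(\<exists>r>R. V (r\<^sup>2 / 2) = 0) \<and> periodic ?u \<and> periodic ?v" if card: "CARD('n) = 1" for R
    proof -
      interpret U: undamped_trajectory l L d K h V Q \<eta>
        by unfold_locales (simp add: d_def card)
      obtain p where p: "0 < p" "\<And>r. T.v (r + p) = T.v r" by (rule U.periodic_v) blast
      obtain r where "R < r" "T.v r = 0" by (rule U.zeros)
      then show ?thesis using p periodic_radial[OF card p(1)] by (auto simp: T.v_def)
    qed
    moreover have "(\<exists>r>R. V (r\<^sup>2 / 2) = 0) \<and> localized ?u \<and> localized ?v" if card: "CARD('n) \<ge> 2" for R
    proof -
      have "continuous_on {0..\<eta>} h" by (rule continuous_on_subset[OF T.continuous_g]) auto
      then have cont: "continuous_on {0..\<eta>} g"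
        by (rule continuous_on_cong[THEN iffD1, rotated 2]) (auto simp: h_eq)
      have "g 0 = 0" using g2[of 0] by simp
      then obtain c where c: "0 < c" "\<And>s. 0 < s \<Longrightarrow> s \<le> \<eta> \<Longrightarrow> c * s \<le> g s"
        using linear_lower_bound[of g \<eta>] g4[OF card] cont g_pos \<eta> by metis
      interpret D: damped_trajectory l L d K h V Q \<eta> c
        by unfold_locales (use card c h_eq in \<open>auto simp: d_def\<close>)
      obtain r where "R < r" "T.v r = 0" by (rule D.zeros)
      moreover have "localized ?u"
        using D.tendsto_0 by (intro T.localized_radial) (simp_all add: T.v_def[abs_def] T.y_def[abs_def] T.p_def[abs_def])
      moreover have "localized ?v"
        using D.tendsto_0[THEN tendsto_minus]
        by (intro m.localized_radial) (simp_all add: T.v_def[abs_def] T.y_def[abs_def] T.p_def[abs_def])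
      ultimately show ?thesis by (auto simp: T.v_def)
    qed
    moreover have "CARD('n) = 1 \<or> CARD('n) \<ge> 2" using zero_less_card_finite[where 'a='n] by linarith
    ultimately show "\<exists>r>R. V (r\<^sup>2 / 2) = 0" "CARD('n) = 1 \<Longrightarrow> periodic ?u \<and> periodic ?v"
      "CARD('n) \<ge> 2 \<Longrightarrow> localized ?u \<and> localized ?v" by blast+
  qed
  have "oscillating ?u" "oscillating ?v"
    by (rule oscillating_radial, use zeros in simp)+
  then show thesis
    using sol per loc VQ(2) by (intro that[of ?u]) (auto simp: u_eq radial_def[of V 0])
qed

theorem theorem1p2:
  fixes l L :: real and g :: "real \<Rightarrow> real"
  assumes "0 < l" and "l \<le> L"
    and g1: "local_lipschitz (UNIV :: real set) UNIV (\<lambda>_. g)"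
    and g2: "\<forall>s. g (- s) = - g s"
    and g3: "\<exists>\<alpha>::ereal. 0 < \<alpha> \<and> (\<forall>s::real. 0 < s \<and> ereal s < \<alpha> \<longrightarrow> g s > 0) \<and>
               (\<forall>s::real. \<alpha> < ereal s \<longrightarrow> g s < 0)"
    and g4: "CARD('n::finite) \<ge> 2 \<Longrightarrow> g differentiable (at 0) \<and> deriv g 0 > 0"
  shows "infinite {u :: real^'n \<Rightarrow> real. C2_solution (pucci_plus l L) g u \<and> oscillating u \<and>
           (CARD('n) = 1 \<longrightarrow> periodic u) \<and> (CARD('n) \<ge> 2 \<longrightarrow> localized u)}
       \<and> infinite {u :: real^'n \<Rightarrow> real. C2_solution (pucci_minus l L) g u \<and> oscillating u \<and>
           (CARD('n) = 1 \<longrightarrow> periodic u) \<and> (CARD('n) \<ge> 2 \<longrightarrow> localized u)}"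
    (is "infinite ?plus \<and> infinite ?minus")
proof -
  obtain \<alpha> :: ereal where \<alpha>: "0 < \<alpha>" "\<And>s::real. 0 < s \<Longrightarrow> ereal s < \<alpha> \<Longrightarrow> g s > 0"
    using g3 by blast
  \<comment> \<open>Each \<open>\<eta>\<close> in \<open>{0<..<a}\<close> gives a solution with \<open>u 0 = \<eta>\<close>, so different \<open>\<eta>\<close> give different solutions.\<close>
  obtain a :: real where a: "0 < a" "ereal a < \<alpha>"
    using ereal_dense2[OF \<alpha>(1)] by auto
  have *: "\<exists>u. u \<in> ?minus \<and> u 0 = \<eta> \<and> (\<lambda>x. - u x) \<in> ?plus" if \<eta>: "\<eta> \<in> {0<..<a}" for \<eta>
  proof -
    have pos: "0 < g s" if "0 < s" "s \<le> \<eta>" for s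
    proof (rule \<alpha>(2)[OF that(1)])
      have "ereal s \<le> ereal a" using that \<eta> by simp
      then show "ereal s < \<alpha>" using a(2) by (rule le_less_trans)
    qed
    have \<eta>0: "0 < \<eta>" using \<eta> by simp
    show ?thesis
      by (rule exists_radial_solutions[OF assms(1,2) g1 g2[rule_format] \<eta>0 pos g4]) auto
  qed
  have inf: "infinite {0<..<a}" using a(1) by (rule infinite_Ioo)
  have "{0<..<a} \<subseteq> (\<lambda>u. u 0) ` ?minus" using * by (fastforce simp: image_iff)
  then have "infinite ?minus" using inf by (meson finite_imageI finite_subset)
  moreover have "{0<..<a} \<subseteq> (\<lambda>u. - u 0) ` ?plus"
  proof
    fix \<eta> assume "\<eta> \<in> {0<..<a}"
    from *[OF this] obtain u where "u 0 = \<eta>" "(\<lambda>x. - u x) \<in> ?plus" by blast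
    then show "\<eta> \<in> (\<lambda>u. - u 0) ` ?plus" by (intro image_eqI[of _ _ "\<lambda>x. - u x"]) simp_all
  qed
  then have "infinite ?plus" using inf by (meson finite_imageI finite_subset)
  ultimately show ?thesis by blast
qed

end
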